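(* (Embedding) If $\psi$ is an $\mathcal L_{\mathsf{ID}}$-sentence with $\mathsf{ID}_1\vdash\psi$, then for every nice operator $\mathcal H$ there are $m,n\in\mathbb N$ with $\mathcal H\vdash^{\Omega\cdot2+n}_{\Omega+m}\psi^+$, where $\Omega\cdot 2=\Omega+\Omega$.
   Context: $\mathsf{ID}_1$: formulas are in negation normal form; an operator form is a formula $\varphi(x,X)$ of arithmetic with an extra unary predicate $X$, with one free number variable and no subformula $\neg Xt$. $\mathcal L_{\mathsf{ID}}$ extends $\mathcal L_{\mathsf{PA}}$ by a predicate $I_\varphi$ for each operator form; $\mathsf{ID}_1$ is Peano arithmetic with equality and induction for all $\mathcal L_{\mathsf{ID}}$-formulas plus (F) $\forall x(\varphi(x,I_\varphi)\to I_\varphi x)$ and (L) $\forall x(\varphi(x,\psi)\to\psi(x))\to\forall x(I_\varphi x\to\psi(x))$ for all operator forms $\varphi$ and $\mathcal L_{\mathsf{ID}}$-formulas $\psi$ ($\varphi(x,\psi)$ replaces each $Xt$ by $\psi(t)$). Ordinal terms: The set $\vartheta(\varepsilon_{\Omega+1})$ of terms, a relation $\prec$ and finite sets $E(\alpha)$ are defined by simultaneous recursion on term length: Terms: $\Omega$; $\vartheta\alpha$ for each term $\alpha$; $\langle\alpha_0,\dots,\alpha_{n-1}\rangle$ ($n\ge0$) provided that if $n>1$ then $\alpha_{n-1}\preceq\dots\preceq\alpha_0$ ($\preceq$ is $\prec$ or syntactic equality), and if $n=1$ then $\alpha_0$ is not $\Omega$ or of the form $\vartheta\beta$. $E(\Omega)=\emptyset$,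 $E(\vartheta\alpha)=\{\vartheta\alpha\}$, $E(\langle\alpha_0,\dots\rangle)=\bigcup_iE(\alpha_i)$. $\alpha\prec\beta$ iff: (1) $\alpha=\Omega$, $\beta=\langle\beta_0,\dots,\beta_{n-1}\rangle$, $n>0$, $\Omega\preceq\beta_0$; or (2) $\alpha=\vartheta\alpha'$ and either $\beta=\Omega$, or $\beta=\langle\beta_0,\dots\rangle$ nonempty with $\alpha\preceq\beta_0$, or $\beta=\vartheta\beta'$ with $\alpha'\prec\beta'$ and $\gamma\prec\beta$ for all $\gamma\in E(\alpha')$, or $\beta=\vartheta\beta'$ with $\alpha\preceq\gamma$ for some $\gamma\in E(\beta')$; or (3) $\alpha=\langle\alpha_0,\dots,\alpha_{m-1}\rangle$ and either $\beta\in\{\Omega\}\cup\{\vartheta\beta'\}$ with ($m=0$ or $\alpha_0\prec\beta$), or $\beta=\langle\beta_0,\dots,\beta_{n-1}\rangle$ is lexicographically larger ($\alpha$ a proper initial segment of $\beta$, or first difference $\alpha_j\prec\beta_j$). Numerals: $n:=\langle0,\dots,0\rangle$ ($n$ entries, $0=\langle\rangle$), $\omega:=\langle 1\rangle$. Addition: identify $\Omega,\vartheta\alpha$ with $\langle\Omega\rangle,\langle\vartheta\alpha\rangle$ and set $\langle\alpha_0,\dots,\alpha_{m-1}\rangle+\langle\beta_0,\dots,\beta_{n-1}\rangle=\langle\alpha_0,\dots,\alpha_{k-1},\beta_0,\dots,\beta_{n-1}\rangle$ where $k$ is largest such that $\beta_0\preceq\alpha_{k-1}$ (all of $\alpha$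 if $n=0$; $k=0$ if no such); $\omega\cdot\Omega=\Omega$, $\omega\cdot\vartheta\alpha=\vartheta\alpha$, $\omega\cdot\langle\alpha_0,\dots\rangle=\langle1+\alpha_0,\dots\rangle$. Infinitary language: $\mathcal L^\Omega_{\mathsf{ID}}$ extends $\mathcal L_{\mathsf{PA}}$ by predicates $I^{\prec\alpha}_\varphi$ for each operator form $\varphi$ and term $\alpha\preceq\Omega$; $\psi^+$ replaces each $I_\varphi$ in an $\mathcal L_{\mathsf{ID}}$-formula by $I^{\prec\Omega}_\varphi$; $\varphi(t,I^{\prec\gamma}_\varphi)$ replaces $x$ by $t$ and $Xs$ by $I^{\prec\gamma}_\varphi s$. Each sentence is assigned a disjunction or conjunction: a false $\mathcal L_{\mathsf{PA}}$-literal $\simeq$ empty disjunction; $I^{\prec\alpha}_\varphi t\simeq\bigvee_{\gamma\prec\alpha}\varphi(t,I^{\prec\gamma}_\varphi)$; $\psi_0\lor\psi_1\simeq\bigvee_{i\prec2}\psi_i$; $\exists x\,\psi(x)\simeq\bigvee_{n\prec\omega}\psi(n)$; and $\neg\psi\simeq\bigwedge_{\gamma\prec\alpha}\neg\psi_\gamma$ whenever $\psi\simeq\bigvee_{\gamma\prec\alpha}\psi_\gamma$. Ranks: $\operatorname{rk}=0$ for $\mathcal L_{\mathsf{PA}}$-literals, $\operatorname{rk}(\pm I^{\prec\alpha}_\varphi t)=\omega\cdot\alpha$, $\operatorname{rk}(\psi_0\lor\psi_1)=\operatorname{rk}(\psi_0\land\psi_1)=\max(\operatorname{rk}\psi_0,\operatorname{rk}\psi_1)+1$,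 $\operatorname{rk}(\exists x\psi)=\operatorname{rk}(\forall x\psi)=\operatorname{rk}(\psi)+1$. $k(\psi)$ is the set of $\alpha$ such that $\psi$ contains a literal $I^{\prec\alpha}_\varphi t$ or $\neg I^{\prec\alpha}_\varphi t$; for a sequent (finite set of sentences) $k(\Gamma)=\bigcup_{\psi\in\Gamma}k(\psi)$. Operators: with $\mathcal P$ the powerset of $\vartheta(\varepsilon_{\Omega+1})$, a nice operator is $\mathcal H:\mathcal P\to\mathcal P$ with $X\subseteq\mathcal H(X)$, ($X\subseteq\mathcal H(Y)\Rightarrow\mathcal H(X)\subseteq\mathcal H(Y)$), and ($\alpha\in\mathcal H(X)\Leftrightarrow E(\alpha)\subseteq\mathcal H(X)$); $\mathcal H[Z](X):=\mathcal H(Z\cup X)$. Derivations: $\mathcal H\vdash^\alpha_\rho\Gamma$ is defined by recursion on $\alpha$: it holds iff $\{\alpha\}\cup k(\Gamma)\subseteq\mathcal H(\emptyset)$ and one of: ($\bigwedge$) some $\psi\simeq\bigwedge_{\gamma\prec\delta}\psi_\gamma$ in $\Gamma$ such that for every $\gamma\prec\delta$ there is $\alpha(\gamma)\prec\alpha$ with $\mathcal H[\{\gamma\}]\vdash^{\alpha(\gamma)}_\rho\Gamma\cup\{\psi_\gamma\}$; ($\bigvee$) some $\psi\simeq\bigvee_{\gamma\prec\delta}\psi_\gamma$ in $\Gamma$, some $\gamma\prec\delta$ with $\gamma\prec\alpha$ and $\gamma\in\mathcal H(\emptyset)$, and $\alpha'\prec\alpha$ with $\mathcal H\vdash^{\alpha'}_\rho\Gamma\cup\{\psi_\gamma\}$;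 (Cut) some sentence $\psi$ with $\operatorname{rk}(\psi)\prec\rho$ and $\alpha'\prec\alpha$ with $\mathcal H\vdash^{\alpha'}_\rho\Gamma\cup\{\psi\}$ and $\mathcal H\vdash^{\alpha'}_\rho\Gamma\cup\{\neg\psi\}$; (Fix) $\Omega\preceq\alpha$, some $I^{\prec\Omega}_\varphi t\in\Gamma$ and $\alpha'\prec\alpha$ with $\mathcal H\vdash^{\alpha'}_\rho\Gamma\cup\{\varphi(t,I^{\prec\Omega}_\varphi)\}$. A single sentence is identified with the one-element sequent. *)

theory Defs
  imports Main
begin

section \<open>Ordinal terms\<close>

text \<open>
  The order and the sets \<open>E(\<alpha>)\<close> only look at subterms. They are therefore defined on arbitrary
  preterms first, and the side conditions on sequences are imposed afterwards by \<open>is_ot\<close>.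
\<close>

datatype preterm = POm | PTh preterm | PSq "preterm list"

fun pE :: "preterm \<Rightarrow> preterm set" where
  "pE POm = {}"
| "pE (PTh a) = {PTh a}"
| "pE (PSq as) = (\<Union>a\<in>set as. pE a)"

lemma size_mem: "a \<in> set as \<Longrightarrow> size a \<le> size_list size as"
  by (rule size_list_estimation') auto

lemma size_pE: "g \<in> pE a \<Longrightarrow> size g \<le> size a"
proof (induction a rule: pE.induct)
  case (3 as)
  then obtain a where a: "a \<in> set as" "g \<in> pE a" by auto
  then have "size g \<le> size a" using 3 by blast
  then show ?case using size_mem[OF a(1)] by simp
qed auto

function plt :: "preterm \<Rightarrow> preterm \<Rightarrow> bool" where
  "plt POm POm = False"
| "plt POm (PTh b) = False"
| "plt POm (PSq bs) = (case bs of [] \<Rightarrow> False | b # _ \<Rightarrow> plt POm b \<or> POm = b)"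
| "plt (PTh a) POm = True"
| "plt (PTh a) (PSq bs) = (case bs of [] \<Rightarrow> False | b # _ \<Rightarrow> plt (PTh a) b \<or> PTh a = b)"
| "plt (PTh a) (PTh b) =
    ((plt a b \<and> (\<forall>g\<in>pE a. plt g (PTh b))) \<or>
     (\<exists>g\<in>pE b. plt (PTh a) g \<or> PTh a = g))"
| "plt (PSq as) POm = (case as of [] \<Rightarrow> True | a # _ \<Rightarrow> plt a POm)"
| "plt (PSq as) (PTh b) = (case as of [] \<Rightarrow> True | a # _ \<Rightarrow> plt a (PTh b))"
| "plt (PSq as) (PSq bs) =
    ((\<exists>c cs. bs = as @ c # cs) \<or>
     (\<exists>j\<in>{..<min (length as) (length bs)}. take j as = take j bs \<and> plt (as ! j) (bs ! j)))"
  by pat_completeness auto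
termination
proof (relation "measure (\<lambda>(a, b). size a + size b)", goal_cases)
  case (9 as bs j)
  then have "size (as ! j) \<le> size_list size as" "size (bs ! j) \<le> size_list size bs"
    by (auto intro!: size_mem nth_mem)
  then show ?case by simp
next
  case (4 a b)
  then show ?case by simp
next
  case (5 a b g)
  then show ?case using size_pE[of g a] by simp
next
  case (6 a b g)
  then show ?case using size_pE[of g b] by simp
qed (auto simp: less_Suc_eq_le intro!: size_mem)

abbreviation ple :: "preterm \<Rightarrow> preterm \<Rightarrow> bool" where
  "ple a b \<equiv> plt a b \<or> a = b"

fun is_principal :: "preterm \<Rightarrow> bool" where
  "is_principal POm = True"
| "is_principal (PTh a) = True"
| "is_principal (PSq as) = False"

fun is_ot :: "preterm \<Rightarrow> bool" where
  "is_ot POm = True"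
| "is_ot (PTh a) = is_ot a"
| "is_ot (PSq as) =
    ((\<forall>a\<in>set as. is_ot a) \<and> successively (\<lambda>a b. ple b a) as \<and>
     (length as = 1 \<longrightarrow> \<not> is_principal (hd as)))"

text \<open>The identification of \<open>\<Omega>\<close> and \<open>\<vartheta>\<alpha>\<close> with one-element sequences, in both directions.\<close>

fun entries :: "preterm \<Rightarrow> preterm list" where
  "entries POm = [POm]"
| "entries (PTh a) = [PTh a]"
| "entries (PSq as) = as"

definition of_entries :: "preterm list \<Rightarrow> preterm" where
  "of_entries as = (if length as = 1 \<and> is_principal (hd as) then hd as else PSq as)"

definition pplus :: "preterm \<Rightarrow> preterm \<Rightarrow> preterm" where
  "pplus a b = (let as = entries a; bs = entries b in
     if bs = [] then a
     else of_entries
       (take (Max {k. k \<le> length as \<and> (k = 0 \<or> ple (hd bs) (as ! (k - 1)))}) as @ bs))"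

definition pfin :: "nat \<Rightarrow> preterm" where
  "pfin n = PSq (replicate n (PSq []))"

fun pomega_times :: "preterm \<Rightarrow> preterm" where
  "pomega_times POm = POm"
| "pomega_times (PTh a) = PTh a"
| "pomega_times (PSq as) = PSq (map (pplus (pfin 1)) as)"


subsection \<open>Closure of the terms under these operations\<close>

lemma is_ot_pE: "is_ot a \<Longrightarrow> g \<in> pE a \<Longrightarrow> is_ot g"
  by (induction a rule: pE.induct) auto

lemma is_ot_pfin: "is_ot (pfin n)"
proof -
  have "successively (\<lambda>a b. ple b a) (replicate n (PSq []))"
    by (auto simp: successively_conv_nth)
  then show ?thesis by (cases n) (auto simp: pfin_def)
qed

lemma is_ot_entries:
  assumes "is_ot a"
  shows "(\<forall>x\<in>set (entries a). is_ot x) \<and> successively (\<lambda>a b. ple b a) (entries a)"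
  using assms by (cases a) auto

lemma is_ot_of_entries:
  assumes "\<forall>x\<in>set as. is_ot x" "successively (\<lambda>a b. ple b a) as"
  shows "is_ot (of_entries as)"
  using assms by (cases as) (auto simp: of_entries_def)

lemma is_ot_pplus:
  assumes "is_ot a" "is_ot b"
  shows "is_ot (pplus a b)"
proof (cases "entries b = []")
  case True
  then show ?thesis using assms by (simp add: pplus_def Let_def)
next
  case False
  define as bs where "as = entries a" and "bs = entries b"
  define K where "K = {k. k \<le> length as \<and> (k = 0 \<or> ple (hd bs) (as ! (k - 1)))}"
  define k where "k = Max K"
  have "finite K" "0 \<in> K" by (auto simp: K_def)
  then have "k \<in> K" unfolding k_def by (metis Max_in empty_iff)
  then have k: "k \<le> length as" "k = 0 \<or> ple (hd bs) (as ! (k - 1))" by (auto simp: K_def)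
  have as: "\<forall>x\<in>set as. is_ot x" "successively (\<lambda>a b. ple b a) as"
    and bs: "\<forall>x\<in>set bs. is_ot x" "successively (\<lambda>a b. ple b a) bs"
    using is_ot_entries assms by (auto simp: as_def bs_def)
  have "successively (\<lambda>a b. ple b a) (take k as)"
    using as(2) by (auto simp: successively_conv_nth)
  moreover have "take k as \<noteq> [] \<Longrightarrow> ple (hd bs) (last (take k as))"
    using k by (auto simp: last_conv_nth min_def)
  ultimately have "successively (\<lambda>a b. ple b a) (take k as @ bs)"
    using bs(2) by (auto simp: successively_append_iff)
  then have "is_ot (of_entries (take k as @ bs))"
    using as(1) bs(1) by (intro is_ot_of_entries) (auto dest: in_set_takeD)
  then show ?thesis
    using False by (simp add: pplus_def Let_def as_def bs_def k_def K_def)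
qed

lemma plt_PSqE:
  assumes "plt (PSq as) (PSq bs)"
  obtains c cs where "bs = as @ c # cs"
  | j where "j < length as" "j < length bs" "take j as = take j bs" "plt (as ! j) (bs ! j)"
  using assms unfolding plt.simps lessThan_iff min_less_iff_conj Bex_def by blast

lemma plt_PSqI:
  assumes "j < length as" "j < length bs" "take j as = take j bs" "plt (as ! j) (bs ! j)"
  shows "plt (PSq as) (PSq bs)"
  using assms unfolding plt.simps lessThan_iff min_less_iff_conj Bex_def by blast

lemma zero_plt: "plt (PSq []) a \<longleftrightarrow> a \<noteq> PSq []"
  by (cases a) (auto simp: neq_Nil_conv)

lemma not_plt_zero: "\<not> plt a (PSq [])"
  by (cases a) auto

lemma one_pplus:
  assumes "is_ot a"
  shows "pplus (pfin (Suc 0)) a =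
    (case a of PSq as \<Rightarrow> if as = [] \<or> hd as = PSq [] then PSq (PSq [] # as) else a | _ \<Rightarrow> a)"
proof -
  let ?K = "\<lambda>x. {k. k \<le> length [PSq []] \<and> (k = 0 \<or> ple x ([PSq []] ! (k - 1)))}"
  have "?K x = (if x = PSq [] then {0, 1} else {0})" for x
    by (auto simp: not_plt_zero le_Suc_eq)
  then have "Max (?K x) = (if x = PSq [] then 1 else 0)" for x
    by simp
  then show ?thesis
    using assms
    by (cases a) (auto simp: pplus_def pfin_def Let_def of_entries_def numeral_eq_Suc)
qed

lemma one_pplus_mono:
  assumes "is_ot a" "is_ot b" "ple a b"
  shows "ple (pplus (pfin 1) a) (pplus (pfin 1) b)"
proof (cases "a = b")
  case False
  then have lt: "plt a b" using assms by simp
  show ?thesis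
  proof (cases "\<exists>as. a = PSq as \<and> (as = [] \<or> hd as = PSq [])")
    case True
    then obtain as where a: "a = PSq as" "as = [] \<or> hd as = PSq []" by blast
    show ?thesis
    proof (cases b)
      case (PSq bs)
      show ?thesis
      proof (cases "bs = [] \<or> hd bs = PSq []")
        case True
        have "plt (PSq (PSq [] # as)) (PSq (PSq [] # bs))"
        proof -
          have "plt (PSq as) (PSq bs)" using lt a(1) PSq by (simp only:)
          then show ?thesis
          proof (cases rule: plt_PSqE)
            case (2 j)
            then show ?thesis by (intro plt_PSqI[of "Suc j"]) auto
          qed auto
        qed
        then show ?thesis using a PSq assms True by (simp add: one_pplus)
      next
        case False
        then have "plt (PSq []) (hd bs)" by (simp add: zero_plt)
        then have "plt (PSq (PSq [] # as)) (PSq bs)"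
          using False by (intro plt_PSqI[of 0]) (auto simp: hd_conv_nth)
        then show ?thesis using a PSq assms False by (simp add: one_pplus)
      qed
    qed (use a assms in \<open>auto simp: one_pplus\<close>)
  next
    case nfin: False
    have "\<not> (\<exists>bs. b = PSq bs \<and> (bs = [] \<or> hd bs = PSq []))"
    proof
      assume "\<exists>bs. b = PSq bs \<and> (bs = [] \<or> hd bs = PSq [])"
      then obtain bs where b: "b = PSq bs" "bs = [] \<or> hd bs = PSq []" by blast
      show False
      proof (cases a)
        case (PSq as)
        then have as: "as \<noteq> []" "hd as \<noteq> PSq []" using nfin by auto
        have "plt (PSq as) (PSq bs)" using lt PSq b(1) by (simp only:)
        then show False
        proof (cases rule: plt_PSqE)
          case 1
          then show False using as b(2) by (auto simp: hd_append)
        next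
          case (2 j)
          then have hb: "hd bs = PSq []" using b(2) by auto
          show False
          proof (cases j)
            case 0
            then show False using 2 hb by (auto simp: hd_conv_nth[symmetric] not_plt_zero)
          next
            case (Suc i)
            then have "hd as = hd bs" using 2(3) as(1) 2(2) by (metis hd_take zero_less_Suc)
            then show False using hb as by simp
          qed
        qed
      qed (use lt b not_plt_zero in \<open>auto split: list.splits\<close>)
    qed
    then have "pplus (pfin 1) b = b" using assms by (auto simp: one_pplus split: preterm.splits)
    moreover have "pplus (pfin 1) a = a" using nfin assms by (auto simp: one_pplus split: preterm.splits)
    ultimately show ?thesis using lt by simp
  qed
qed simp

lemma is_ot_pomega_times:
  assumes "is_ot a"
  shows "is_ot (pomega_times a)"
proof (cases a)
  case (PSq as)
  have m: "\<forall>x\<in>set as. is_ot x" and s: "successively (\<lambda>a b. ple b a) as"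
    and np: "length as = 1 \<longrightarrow> \<not> is_principal (hd as)"
    using assms PSq by auto
  have "\<forall>x\<in>set (map (pplus (pfin 1)) as). is_ot x"
    using m is_ot_pplus is_ot_pfin by auto
  moreover have "successively (\<lambda>a b. ple b a) (map (pplus (pfin 1)) as)"
    unfolding successively_conv_nth
  proof (intro allI impI)
    fix i assume i: "Suc i < length (map (pplus (pfin 1)) as)"
    then have "ple (as ! Suc i) (as ! i)" using s by (auto simp: successively_conv_nth)
    then have "ple (pplus (pfin 1) (as ! Suc i)) (pplus (pfin 1) (as ! i))"
      using i m by (intro one_pplus_mono) auto
    then show "ple (map (pplus (pfin 1)) as ! Suc i) (map (pplus (pfin 1)) as ! i)"
      using i by simp
  qed
  moreover have "length as = 1 \<longrightarrow> \<not> is_principal (hd (map (pplus (pfin 1)) as))"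
    using np m by (cases as) (auto simp: one_pplus split: preterm.splits)
  ultimately show ?thesis using PSq by simp
qed (use assms in auto)


subsection \<open>The type of ordinal terms\<close>

typedef ot = "{a. is_ot a}"
  by (rule exI[of _ POm]) simp

setup_lifting type_definition_ot

lift_definition Omega :: ot is POm by simp

lift_definition coeffs :: "ot \<Rightarrow> ot set" is pE
  using is_ot_pE by (auto simp: Ball_def)

lift_definition fin :: "nat \<Rightarrow> ot" is pfin
  by (rule is_ot_pfin)

lift_definition omega_times :: "ot \<Rightarrow> ot" is pomega_times
  by (rule is_ot_pomega_times)

instantiation ot :: "{ord, plus}"
begin

lift_definition less_ot :: "ot \<Rightarrow> ot \<Rightarrow> bool" is plt .

definition less_eq_ot :: "ot \<Rightarrow> ot \<Rightarrow> bool" where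
  "a \<le> b \<longleftrightarrow> a < b \<or> a = b" for a b :: ot

lift_definition plus_ot :: "ot \<Rightarrow> ot \<Rightarrow> ot" is pplus
  by (rule is_ot_pplus)

instance ..

end

lift_definition omega :: ot is "PSq [pfin 1]"
  using is_ot_pfin[of 1] by (simp add: pfin_def)


section \<open>Formulas in negation normal form\<close>

text \<open>
  Terms and formulas use de Bruijn indices. The type parameter is the set of unary predicate
  symbols added to the language \<open>0, S, +, \<cdot>, =\<close> of arithmetic.
\<close>

datatype tm = Var nat | Zero | Succ tm | Add tm tm | Mul tm tm

datatype (preds: 'p) fm =
    Eq tm tm | Neq tm tm
  | Pos 'p tm | Neg 'p tm
  | And "'p fm" "'p fm" | Or "'p fm" "'p fm"
  | All "'p fm" | Ex "'p fm"
  for map: map_preds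

primrec neg :: "'p fm \<Rightarrow> 'p fm" where
  "neg (Eq s t) = Neq s t"
| "neg (Neq s t) = Eq s t"
| "neg (Pos P t) = Neg P t"
| "neg (Neg P t) = Pos P t"
| "neg (And A B) = Or (neg A) (neg B)"
| "neg (Or A B) = And (neg A) (neg B)"
| "neg (All A) = Ex (neg A)"
| "neg (Ex A) = All (neg A)"

abbreviation Imp :: "'p fm \<Rightarrow> 'p fm \<Rightarrow> 'p fm" where
  "Imp A B \<equiv> Or (neg A) B"

primrec fv_tm :: "tm \<Rightarrow> nat set" where
  "fv_tm (Var i) = {i}"
| "fv_tm Zero = {}"
| "fv_tm (Succ t) = fv_tm t"
| "fv_tm (Add s t) = fv_tm s \<union> fv_tm t"
| "fv_tm (Mul s t) = fv_tm s \<union> fv_tm t"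

primrec fv :: "'p fm \<Rightarrow> nat set" where
  "fv (Eq s t) = fv_tm s \<union> fv_tm t"
| "fv (Neq s t) = fv_tm s \<union> fv_tm t"
| "fv (Pos P t) = fv_tm t"
| "fv (Neg P t) = fv_tm t"
| "fv (And A B) = fv A \<union> fv B"
| "fv (Or A B) = fv A \<union> fv B"
| "fv (All A) = {i. Suc i \<in> fv A}"
| "fv (Ex A) = {i. Suc i \<in> fv A}"

primrec subst_tm :: "(nat \<Rightarrow> tm) \<Rightarrow> tm \<Rightarrow> tm" where
  "subst_tm \<sigma> (Var i) = \<sigma> i"
| "subst_tm \<sigma> Zero = Zero"
| "subst_tm \<sigma> (Succ t) = Succ (subst_tm \<sigma> t)"
| "subst_tm \<sigma> (Add s t) = Add (subst_tm \<sigma> s) (subst_tm \<sigma> t)"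
| "subst_tm \<sigma> (Mul s t) = Mul (subst_tm \<sigma> s) (subst_tm \<sigma> t)"

definition up :: "(nat \<Rightarrow> tm) \<Rightarrow> nat \<Rightarrow> tm" where
  "up \<sigma> = case_nat (Var 0) (\<lambda>i. subst_tm (\<lambda>j. Var (Suc j)) (\<sigma> i))"

primrec subst :: "(nat \<Rightarrow> tm) \<Rightarrow> 'p fm \<Rightarrow> 'p fm" where
  "subst \<sigma> (Eq s t) = Eq (subst_tm \<sigma> s) (subst_tm \<sigma> t)"
| "subst \<sigma> (Neq s t) = Neq (subst_tm \<sigma> s) (subst_tm \<sigma> t)"
| "subst \<sigma> (Pos P t) = Pos P (subst_tm \<sigma> t)"
| "subst \<sigma> (Neg P t) = Neg P (subst_tm \<sigma> t)"
| "subst \<sigma> (And A B) = And (subst \<sigma> A) (subst \<sigma> B)"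
| "subst \<sigma> (Or A B) = Or (subst \<sigma> A) (subst \<sigma> B)"
| "subst \<sigma> (All A) = All (subst (up \<sigma>) A)"
| "subst \<sigma> (Ex A) = Ex (subst (up \<sigma>) A)"

definition shift :: "'p fm \<Rightarrow> 'p fm" where
  "shift = subst (\<lambda>i. Var (Suc i))"

text \<open>
  \<open>inst A t\<close> is \<open>A(t)\<close> where the variable 0 of \<open>A\<close> is discharged, i.e. the remaining indices
  drop by one; \<open>repl A t\<close> also puts \<open>t\<close> for the variable 0, but leaves the other indices alone.
\<close>

definition inst :: "'p fm \<Rightarrow> tm \<Rightarrow> 'p fm" where
  "inst A t = subst (case_nat t Var) A"

definition repl :: "'p fm \<Rightarrow> tm \<Rightarrow> 'p fm" where
  "repl A t = subst (case_nat t (\<lambda>i. Var (Suc i))) A"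

definition sentence :: "'p fm \<Rightarrow> bool" where
  "sentence A \<longleftrightarrow> fv A = {}"

primrec positive :: "'p fm \<Rightarrow> bool" where
  "positive (Eq s t) = True"
| "positive (Neq s t) = True"
| "positive (Pos P t) = True"
| "positive (Neg P t) = False"
| "positive (And A B) = (positive A \<and> positive B)"
| "positive (Or A B) = (positive A \<and> positive B)"
| "positive (All A) = positive A"
| "positive (Ex A) = positive A"

text \<open>The number variable of an operator form has index 0; \<open>X\<close> is the element of \<^typ>\<open>unit\<close>.\<close>

typedef opform = "{A :: unit fm. positive A \<and> fv A \<subseteq> {0}}"
  morphisms form_of Opform
  by (rule exI[of _ "Eq Zero Zero"]) simp

text \<open>\<open>with_pred \<phi> P\<close> is \<open>\<phi>(x, P)\<close> for a predicate symbol \<open>P\<close>.\<close>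

definition with_pred :: "opform \<Rightarrow> 'p \<Rightarrow> 'p fm" where
  "with_pred \<phi> P = map_preds (\<lambda>_. P) (form_of \<phi>)"

text \<open>
  \<open>with_fm A B\<close> replaces each \<open>X t\<close> in \<open>A\<close> by \<open>B(t)\<close>, where 0 is the distinguished variable of
  \<open>B\<close> and the other variables of \<open>B\<close> are parameters, which are lifted below quantifiers of \<open>A\<close>.
\<close>

primrec with_fm :: "unit fm \<Rightarrow> 'p fm \<Rightarrow> 'p fm" where
  "with_fm (Eq s t) B = Eq s t"
| "with_fm (Neq s t) B = Neq s t"
| "with_fm (Pos P t) B = repl B t"
| "with_fm (Neg P t) B = neg (repl B t)"
| "with_fm (And A1 A2) B = And (with_fm A1 B) (with_fm A2 B)"
| "with_fm (Or A1 A2) B = Or (with_fm A1 B) (with_fm A2 B)"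
| "with_fm (All A) B = All (with_fm A (subst (up (\<lambda>i. Var (Suc i))) B))"
| "with_fm (Ex A) B = Ex (with_fm A (subst (up (\<lambda>i. Var (Suc i))) B))"


section \<open>The theory of inductive definitions\<close>

text \<open>
  Classical first-order logic over a set of (possibly open) axioms, as a Tait-style sequent
  calculus. In \<open>All\<close> the eigenvariable is index 0, made fresh by shifting the context.
\<close>

inductive tait :: "'p fm set \<Rightarrow> 'p fm set \<Rightarrow> bool" for T where
  Id: "finite \<Gamma> \<Longrightarrow> A \<in> \<Gamma> \<Longrightarrow> neg A \<in> \<Gamma> \<Longrightarrow> tait T \<Gamma>"
| Axiom: "finite \<Gamma> \<Longrightarrow> A \<in> T \<Longrightarrow> A \<in> \<Gamma> \<Longrightarrow> tait T \<Gamma>"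
| And: "And A B \<in> \<Gamma> \<Longrightarrow> tait T (insert A \<Gamma>) \<Longrightarrow> tait T (insert B \<Gamma>) \<Longrightarrow> tait T \<Gamma>"
| Or1: "Or A B \<in> \<Gamma> \<Longrightarrow> tait T (insert A \<Gamma>) \<Longrightarrow> tait T \<Gamma>"
| Or2: "Or A B \<in> \<Gamma> \<Longrightarrow> tait T (insert B \<Gamma>) \<Longrightarrow> tait T \<Gamma>"
| All: "All A \<in> \<Gamma> \<Longrightarrow> tait T (insert A (shift ` \<Gamma>)) \<Longrightarrow> tait T \<Gamma>"
| Ex: "Ex A \<in> \<Gamma> \<Longrightarrow> tait T (insert (inst A t) \<Gamma>) \<Longrightarrow> tait T \<Gamma>"
| Cut: "tait T (insert A \<Gamma>) \<Longrightarrow> tait T (insert (neg A) \<Gamma>) \<Longrightarrow> tait T \<Gamma>"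

abbreviation (input) "v0 \<equiv> Var 0"
abbreviation (input) "v1 \<equiv> Var 1"
abbreviation (input) "v2 \<equiv> Var 2"
abbreviation (input) "v3 \<equiv> Var 3"

text \<open>Free variables of axioms stand for their universal closure, as \<open>tait\<close> can generalise them.\<close>

inductive_set ID1 :: "opform fm set" where
  eq_refl: "Eq v0 v0 \<in> ID1"
| eq_sym: "Imp (Eq v0 v1) (Eq v1 v0) \<in> ID1"
| eq_trans: "Imp (Eq v0 v1) (Imp (Eq v1 v2) (Eq v0 v2)) \<in> ID1"
| eq_Succ: "Imp (Eq v0 v1) (Eq (Succ v0) (Succ v1)) \<in> ID1"
| eq_Add: "Imp (Eq v0 v1) (Imp (Eq v2 v3) (Eq (Add v0 v2) (Add v1 v3))) \<in> ID1"
| eq_Mul: "Imp (Eq v0 v1) (Imp (Eq v2 v3) (Eq (Mul v0 v2) (Mul v1 v3))) \<in> ID1"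
| eq_I: "Imp (Eq v0 v1) (Imp (Pos \<phi> v0) (Pos \<phi> v1)) \<in> ID1"
| Succ_nonzero: "Neq (Succ v0) Zero \<in> ID1"
| Succ_inj: "Imp (Eq (Succ v0) (Succ v1)) (Eq v0 v1) \<in> ID1"
| Add_Zero: "Eq (Add v0 Zero) v0 \<in> ID1"
| Add_Succ: "Eq (Add v0 (Succ v1)) (Succ (Add v0 v1)) \<in> ID1"
| Mul_Zero: "Eq (Mul v0 Zero) Zero \<in> ID1"
| Mul_Succ: "Eq (Mul v0 (Succ v1)) (Add (Mul v0 v1) v0) \<in> ID1"
| Induction: "Imp (And (inst A Zero) (All (Imp A (repl A (Succ v0))))) (All A) \<in> ID1"
| F: "All (Imp (with_pred \<phi> \<phi>) (Pos \<phi> v0)) \<in> ID1"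
| L: "Imp (All (Imp (with_fm (form_of \<phi>) A) A)) (All (Imp (Pos \<phi> v0) A)) \<in> ID1"

definition ID1_proves :: "opform fm \<Rightarrow> bool" where
  "ID1_proves A \<longleftrightarrow> tait ID1 {A}"


section \<open>The infinitary proof system\<close>

text \<open>The predicate symbol \<open>(\<phi>, \<alpha>)\<close> is \<open>I\<^bsub>\<phi>\<^esub>\<^bsup>\<prec>\<alpha>\<^esup>\<close>; \<open>inf_sentence\<close> enforces \<open>\<alpha> \<preceq> \<Omega>\<close>.\<close>

type_synonym inf_fm = "(opform \<times> ot) fm"

definition params :: "inf_fm \<Rightarrow> ot set" where
  "params A = snd ` preds A"

definition inf_sentence :: "inf_fm \<Rightarrow> bool" where
  "inf_sentence A \<longleftrightarrow> sentence A \<and> (\<forall>\<alpha>\<in>params A. \<alpha> \<le> Omega)"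

definition sequent :: "inf_fm set \<Rightarrow> bool" where
  "sequent \<Gamma> \<longleftrightarrow> finite \<Gamma> \<and> (\<forall>A\<in>\<Gamma>. inf_sentence A)"

definition plus_fm :: "opform fm \<Rightarrow> inf_fm" where
  "plus_fm = map_preds (\<lambda>\<phi>. (\<phi>, Omega))"

primrec num :: "nat \<Rightarrow> tm" where
  "num 0 = Zero"
| "num (Suc n) = Succ (num n)"

text \<open>Only values of closed terms matter; the value of a variable is a dummy.\<close>

primrec tval :: "tm \<Rightarrow> nat" where
  "tval (Var i) = 0"
| "tval Zero = 0"
| "tval (Succ t) = Suc (tval t)"
| "tval (Add s t) = tval s + tval t"
| "tval (Mul s t) = tval s * tval t"

text \<open>
  \<open>is_disj A \<delta> F\<close> means \<open>A \<simeq> \<Or>\<^bsub>\<gamma>\<prec>\<delta>\<^esub> F \<gamma>\<close>, where values of \<open>F\<close> outside \<open>\<gamma> \<prec> \<delta>\<close> are irrelevant;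
  likewise \<open>is_conj\<close>. The terms below \<open>fin 2\<close> and \<open>omega\<close> are numerals.
\<close>

inductive is_disj :: "inf_fm \<Rightarrow> ot \<Rightarrow> (ot \<Rightarrow> inf_fm) \<Rightarrow> bool" where
  false_Eq: "tval s \<noteq> tval t \<Longrightarrow> is_disj (Eq s t) (fin 0) F"
| false_Neq: "tval s = tval t \<Longrightarrow> is_disj (Neq s t) (fin 0) F"
| Pos: "is_disj (Pos (\<phi>, \<alpha>) t) \<alpha> (\<lambda>\<gamma>. inst (with_pred \<phi> (\<phi>, \<gamma>)) t)"
| Or: "F (fin 0) = A \<Longrightarrow> F (fin 1) = B \<Longrightarrow> is_disj (Or A B) (fin 2) F"
| Ex: "(\<And>n. F (fin n) = inst A (num n)) \<Longrightarrow> is_disj (Ex A) omega F"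

inductive is_conj :: "inf_fm \<Rightarrow> ot \<Rightarrow> (ot \<Rightarrow> inf_fm) \<Rightarrow> bool" where
  "is_disj A \<delta> F \<Longrightarrow> is_conj (neg A) \<delta> (\<lambda>\<gamma>. neg (F \<gamma>))"

primrec rk :: "inf_fm \<Rightarrow> ot" where
  "rk (Eq s t) = fin 0"
| "rk (Neq s t) = fin 0"
| "rk (Pos P t) = omega_times (snd P)"
| "rk (Neg P t) = omega_times (snd P)"
| "rk (And A B) = max (rk A) (rk B) + fin 1"
| "rk (Or A B) = max (rk A) (rk B) + fin 1"
| "rk (All A) = rk A + fin 1"
| "rk (Ex A) = rk A + fin 1"

definition nice :: "(ot set \<Rightarrow> ot set) \<Rightarrow> bool" where
  "nice H \<longleftrightarrow>
    (\<forall>X. X \<subseteq> H X) \<and>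
    (\<forall>X Y. X \<subseteq> H Y \<longrightarrow> H X \<subseteq> H Y) \<and>
    (\<forall>X \<alpha>. \<alpha> \<in> H X \<longleftrightarrow> coeffs \<alpha> \<subseteq> H X)"

definition relativize :: "(ot set \<Rightarrow> ot set) \<Rightarrow> ot set \<Rightarrow> ot set \<Rightarrow> ot set" where
  "relativize H Z X = H (Z \<union> X)"

definition controlled :: "(ot set \<Rightarrow> ot set) \<Rightarrow> ot \<Rightarrow> inf_fm set \<Rightarrow> bool" where
  "controlled H \<alpha> \<Gamma> \<longleftrightarrow> sequent \<Gamma> \<and> {\<alpha>} \<union> (\<Union>A\<in>\<Gamma>. params A) \<subseteq> H {}"

text \<open>
  The recursion on \<open>\<alpha>\<close> is expressed as an inductive definition: each premise of a rule carries a
  smaller ordinal term than its conclusion.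
\<close>

inductive derivation :: "(ot set \<Rightarrow> ot set) \<Rightarrow> ot \<Rightarrow> ot \<Rightarrow> inf_fm set \<Rightarrow> bool" where
  Conj: "\<lbrakk>controlled H \<alpha> \<Gamma>; A \<in> \<Gamma>; is_conj A \<delta> F;
    \<forall>\<gamma><\<delta>. \<exists>\<alpha>'<\<alpha>. derivation (relativize H {\<gamma>}) \<alpha>' \<rho> (\<Gamma> \<union> {F \<gamma>})\<rbrakk>
    \<Longrightarrow> derivation H \<alpha> \<rho> \<Gamma>"
| Disj: "\<lbrakk>controlled H \<alpha> \<Gamma>; A \<in> \<Gamma>; is_disj A \<delta> F;
    \<gamma> < \<delta>; \<gamma> < \<alpha>; \<gamma> \<in> H {}; \<alpha>' < \<alpha>; derivation H \<alpha>' \<rho> (\<Gamma> \<union> {F \<gamma>})\<rbrakk>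
    \<Longrightarrow> derivation H \<alpha> \<rho> \<Gamma>"
| Cut: "\<lbrakk>controlled H \<alpha> \<Gamma>; inf_sentence A; rk A < \<rho>; \<alpha>' < \<alpha>;
    derivation H \<alpha>' \<rho> (\<Gamma> \<union> {A}); derivation H \<alpha>' \<rho> (\<Gamma> \<union> {neg A})\<rbrakk>
    \<Longrightarrow> derivation H \<alpha> \<rho> \<Gamma>"
| Fix: "\<lbrakk>controlled H \<alpha> \<Gamma>; Omega \<le> \<alpha>; Pos (\<phi>, Omega) t \<in> \<Gamma>; \<alpha>' < \<alpha>;
    derivation H \<alpha>' \<rho> (\<Gamma> \<union> {inst (with_pred \<phi> (\<phi>, Omega)) t})\<rbrakk>
    \<Longrightarrow> derivation H \<alpha> \<rho> \<Gamma>"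

end

theory Submission
  imports Defs "HOL-Library.Multiset"
begin

text \<open>
  The relation \<open>\<prec>\<close> is well-founded: let \<open>W\<close> be the accessible part of the terms below \<open>\<Omega>\<close>. The terms
  \<open>\<alpha>\<close> with \<open>E(\<alpha>) \<subseteq> W\<close> are built from \<open>\<Omega>\<close> and \<open>W\<close> by decreasing sequences, hence well-founded, and
  induction along them shows \<open>\<vartheta>\<alpha> \<in> W\<close>.

  Hence one can derive \<open>\<not>I\<^bsup>\<prec>\<gamma>\<^esup>t, I\<^bsup>\<prec>\<gamma>\<^esup>t\<close> by recursion on \<open>\<gamma> \<preceq> \<Omega>\<close>, with height about \<open>\<omega>\<^bsup>1+\<gamma>\<^esup>\<close>, and
  all tautologies of the language of \<open>ID\<^sub>1\<close> with height \<open>\<Omega> + k\<close>. Axiom (F) is an instance of the rule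
  (Fix). For axiom (L), induction on \<open>\<gamma>\<close> derives \<open>\<psi>(t)\<close> from \<open>I\<^bsup>\<prec>\<gamma>\<^esup>t\<close> and the closure of \<open>\<psi>\<close>, with height
  about \<open>\<Omega> + \<omega>\<^bsup>1+\<gamma>\<^esup>\<close>; for \<open>\<gamma> = \<Omega>\<close> this is \<open>\<Omega>\<cdot>2\<close>. Every inference of \<open>ID\<^sub>1\<close> adds finitely many steps
  and cuts on formulas of rank \<open>\<Omega> + k\<close>. The heights are sequences that are compared at their first
  entries, so neither transitivity nor linearity of \<open>\<prec>\<close> is required.
\<close>

section \<open>Well-foundedness of the ordinal terms\<close>

text \<open>Comparing a sequence with \<open>POm\<close> only looks at its first entry, so the claim
  passes to first entries, which are smaller. If \<open>a = POm\<close>, the induction hypothesis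
  would give \<open>plt POm POm\<close>, so that case is void.\<close>

lemma plt_Omega_downward:
  assumes "plt a b" "plt b POm"
  shows "plt a POm"
  using assms
proof (induction "size a + size b" arbitrary: a b rule: less_induct)
  case less
  show ?case
  proof (cases a)
    case POm
    show ?thesis
    proof (cases b)
      case (PSq bs)
      then obtain c cs where bs: "bs = c # cs" using POm less.prems by (cases bs) auto
      then have "plt POm c" "plt c POm" using PSq POm less.prems by auto
      then have "plt POm POm" using less.hyps[of POm c] bs PSq POm by simp
      then show ?thesis by simp
    qed (use POm less.prems in auto)
  next
    case (PSq as)
    show ?thesis
    proof (cases as)
      case (Cons x xs)
      have "plt x POm"
      proof (cases b)
        case (PTh b')
        then show ?thesis using less.hyps[of x b] less.prems PSq Cons by auto
      next
        case (PSq bs)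
        then have "plt (PSq as) (PSq bs)" using less.prems \<open>a = PSq as\<close> by simp
        then have "bs \<noteq> [] \<and> (x = hd bs \<or> plt x (hd bs))"
        proof (cases rule: plt_PSqE)
          case (2 j)
          then show ?thesis using Cons by (cases j; cases bs) auto
        qed (use Cons in auto)
        moreover from this have "plt (hd bs) POm"
          using PSq less.prems(2) by (cases bs) auto
        ultimately show ?thesis
          using less.hyps[of x "hd bs"] PSq \<open>a = PSq as\<close> Cons by (cases bs) auto
      qed (use less.prems in auto)
      then show ?thesis using PSq Cons by simp
    qed (use PSq in simp)
  qed simp
qed

text \<open>Terms outside \<open>S\<close> have no predecessors in this relation and are trivially
  accessible; hence accessibility is always paired with membership in \<open>S\<close>.\<close>

definition plt_on :: "preterm set \<Rightarrow> (preterm \<times> preterm) set" where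
  "plt_on S = {(a, b). a \<in> S \<and> b \<in> S \<and> plt a b}"

lemma acc_plt_onD:
  assumes "b \<in> Wellfounded.acc (plt_on S)" "b \<in> S" "a \<in> S" "ple a b"
  shows "a \<in> Wellfounded.acc (plt_on S)"
  using assms acc_downward[of b "plt_on S" a] by (auto simp: plt_on_def)

text \<open>
  On weakly decreasing sequences the lexicographic order is contained in the multiset order over
  the transitive closure of \<open>\<prec>\<close>, so transitivity of \<open>\<prec>\<close> itself is not required.
\<close>

lemma PSq_in_acc:
  assumes S: "\<And>a. a \<in> S \<Longrightarrow> is_ot a" "\<And>as. PSq as \<in> S \<Longrightarrow> set as \<subseteq> S"
    and "PSq as \<in> S" "set as \<subseteq> Wellfounded.acc (plt_on S)"
  shows "PSq as \<in> Wellfounded.acc (plt_on S)"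
proof -
  \<comment> \<open>The restriction to accessible terms makes the relation well-founded, and the
    transitive closure keeps it so.\<close>
  define A where "A = Wellfounded.acc (plt_on S) \<inter> S"
  define r where "r = (plt_on S \<inter> A \<times> A)\<^sup>+"
  have "wf (plt_on S \<inter> A \<times> A)"
  proof (rule wfUNIVI)
    fix P x
    assume step: "\<forall>x. (\<forall>y. (y, x) \<in> plt_on S \<inter> A \<times> A \<longrightarrow> P y) \<longrightarrow> P x"
    have "P x" if "x \<in> Wellfounded.acc (plt_on S)" for x
      using that
    proof (induction rule: acc_induct_rule)
      case (1 x)
      then show ?case using step by blast
    qed
    then show "P x" using step unfolding A_def by blast
  qed
  then have "wf (mult r)" unfolding r_def by (intro wf_mult wf_trancl)
  have "\<forall>as. mset as = N \<longrightarrow> PSq as \<in> S \<longrightarrow> set as \<subseteq> A \<longrightarrow> PSq as \<in> Wellfounded.acc (plt_on S)" for N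
    using \<open>wf (mult r)\<close>
  proof (induction N rule: wf_induct_rule)
    case (less N)
    show ?case
    proof (intro allI impI, rule accI)
      fix as b
      assume as: "mset as = N" "PSq as \<in> S" "set as \<subseteq> A" and "(b, PSq as) \<in> plt_on S"
      then have b: "b \<in> S" "plt b (PSq as)" by (auto simp: plt_on_def)
      \<comment> \<open>This settles \<open>b = POm\<close> and \<open>b = PTh _\<close>, for which
        lying below a sequence means lying weakly below its first entry.\<close>
      have principal: "b \<in> Wellfounded.acc (plt_on S)" if "as \<noteq> []" "ple b (hd as)"
      proof -
        have "hd as \<in> A" using that(1) as(3) hd_in_set by blast
        then show ?thesis using acc_plt_onD[OF _ _ b(1) that(2)] by (simp add: A_def)
      qed
      show "b \<in> Wellfounded.acc (plt_on S)"
      proof (cases b)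
        case (PSq bs)
        have bsS: "set bs \<subseteq> S" using S(2) b(1) PSq by blast
        have desc: "successively (\<lambda>a b. ple b a) bs" using S(1)[OF b(1)] PSq by simp
        have "plt (PSq bs) (PSq as)" using b(2) PSq by simp
        then have "set bs \<subseteq> A \<and> (mset bs, N) \<in> mult r"
        proof (cases rule: plt_PSqE)
          case (1 c cs)
          then show ?thesis
            using as one_step_implies_mult[of "mset (c # cs)" "{#}" r "mset bs"] by auto
        next
          case (2 j)
          \<comment> \<open>From the first difference \<open>j\<close> on, every entry of
            \<open>bs\<close> is below \<open>as ! j\<close>: position \<open>j\<close> by the
            choice of \<open>j\<close>, later ones because \<open>bs\<close> decreases weakly and
            \<open>r\<close> is transitive.\<close>
          have later: "bs ! i \<in> A \<and> (bs ! i, as ! j) \<in> r" if "j \<le> i" "i < length bs" for i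
            using that
          proof (induction i rule: dec_induct)
            case base
            have "bs ! j \<in> A"
              using acc_plt_onD[of "as ! j" S "bs ! j"] 2 as(3) bsS
              by (auto simp: A_def subset_iff)
            then show ?case
              using 2 as(3) bsS unfolding r_def
              by (intro conjI r_into_trancl) (auto simp: plt_on_def A_def subset_iff)
          next
            case (step i)
            then have i: "bs ! i \<in> A" "(bs ! i, as ! j) \<in> r" by auto
            have le: "ple (bs ! Suc i) (bs ! i)" using desc step by (auto simp: successively_conv_nth)
            have in_S: "bs ! Suc i \<in> S" using bsS step by auto
            then have in_A: "bs ! Suc i \<in> A"
              using acc_plt_onD[OF _ _ in_S le] i(1) by (auto simp: A_def)
            then have "bs ! Suc i = bs ! i \<or> (bs ! Suc i, bs ! i) \<in> r"
              using le i(1) unfolding r_def by (auto simp: plt_on_def A_def)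
            then show ?case using in_A i(2) unfolding r_def by (metis trancl_trans)
          qed
          have drop: "x \<in> A \<and> (x, as ! j) \<in> r" if x: "x \<in> set (drop j bs)" for x
          proof -
            obtain i where "i < length bs - j" "x = bs ! (j + i)"
              using x by (auto simp: in_set_conv_nth)
            then show ?thesis using later[of "j + i"] by auto
          qed
          have "set bs \<subseteq> A"
            using drop as(3) 2(3) append_take_drop_id[of j bs]
            by (metis UnE set_append set_take_subset subset_iff)
          \<comment> \<open>The common prefix stays; all entries of \<open>bs\<close> from
            \<open>j\<close> on are dominated by the single element \<open>as ! j\<close> of the
            replaced part.\<close>
          moreover have "(mset (take j as) + mset (drop j bs), mset (take j as) + mset (drop j as)) \<in> mult r"
          proof (rule one_step_implies_mult)
            have "as ! j \<in># mset (drop j as)"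
              using Cons_nth_drop_Suc[OF 2(2)] by (metis list.set_intros(1) set_mset_mset)
            then show "\<forall>k\<in>#mset (drop j bs). \<exists>i\<in>#mset (drop j as). (k, i) \<in> r"
              using drop by auto
          qed (use 2 in auto)
          then have "(mset bs, mset as) \<in> mult r"
            using 2(3) by (simp flip: mset_append) (metis append_take_drop_id)
          ultimately show ?thesis using as(1) by simp
        qed
        then show ?thesis using less b(1) PSq by blast
      qed (use principal b(2) in \<open>cases as; simp\<close>)+
    qed
  qed
  moreover have "set as \<subseteq> A" using assms unfolding A_def by blast
  ultimately show ?thesis using assms(3) by blast
qed

section \<open>Countable terms and the accessible part W\<close>

definition countable_terms :: "preterm set" where
  "countable_terms = {a. is_ot a \<and> plt a POm}"

definition acc_terms :: "preterm set" where
  "acc_terms = {a \<in> countable_terms. a \<in> Wellfounded.acc (plt_on countable_terms)}"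

text \<open>W is \<open>acc_terms\<close>. The present set turns out to contain all terms, by
  \<open>is_ot_acc_coeff_terms\<close>.\<close>

definition acc_coeff_terms :: "preterm set" where
  "acc_coeff_terms = {a. is_ot a \<and> pE a \<subseteq> acc_terms}"

text \<open>Carries a downward closed property from the first entry to the others one neighbour at a
  time, since only neighbouring entries are known to be comparable.\<close>

lemma successively_ple_closed:
  assumes "successively (\<lambda>a b. ple b a) as" "as \<noteq> []" "hd as \<in> S"
    and "\<And>a b. b \<in> S \<Longrightarrow> a \<in> set as \<Longrightarrow> plt a b \<Longrightarrow> a \<in> S"
  shows "set as \<subseteq> S"
proof -
  have "as ! i \<in> S" if "i < length as" for i
    using that
  proof (induction i)
    case 0
    then show ?case using assms by (simp add: hd_conv_nth)
  next
    case (Suc i)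
    then have "ple (as ! Suc i) (as ! i)" using assms(1) by (auto simp: successively_conv_nth)
    then show ?case using Suc assms(4)[of "as ! i" "as ! Suc i"] by auto
  qed
  then show ?thesis by (auto simp: in_set_conv_nth)
qed

lemma countable_terms_PSq:
  assumes "PSq as \<in> countable_terms"
  shows "set as \<subseteq> countable_terms"
proof (cases as)
  case (Cons x xs)
  have "set as \<subseteq> {a. plt a POm}"
    using assms Cons plt_Omega_downward
    by (intro successively_ple_closed) (auto simp: countable_terms_def)
  then show ?thesis using assms by (auto simp: countable_terms_def)
qed simp

lemma acc_terms_downward:
  "b \<in> acc_terms \<Longrightarrow> is_ot a \<Longrightarrow> ple a b \<Longrightarrow> a \<in> acc_terms"
  using acc_plt_onD[of b countable_terms a] plt_Omega_downward[of a b]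
  by (auto simp: acc_terms_def countable_terms_def)

lemma PSq_in_acc_terms:
  assumes "is_ot (PSq as)" "set as \<subseteq> acc_terms"
  shows "PSq as \<in> acc_terms"
proof -
  have "PSq as \<in> countable_terms"
    using assms by (cases as) (auto simp: countable_terms_def acc_terms_def)
  moreover from this have "PSq as \<in> Wellfounded.acc (plt_on countable_terms)"
    using assms(2) countable_terms_PSq
    by (intro PSq_in_acc) (auto simp: countable_terms_def acc_terms_def)
  ultimately show ?thesis by (simp add: acc_terms_def)
qed

text \<open>A term \<open>PTh c\<close> is its own coefficient and so lies in W by hypothesis; a
  sequence has entries that are again below \<Omega> with coefficients in W.\<close>

lemma acc_coeff_terms_countable:
  assumes "a \<in> acc_coeff_terms" "plt a POm"
  shows "a \<in> acc_terms"
  using assms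
proof (induction a)
  case (PSq as)
  have "set as \<subseteq> countable_terms"
    using PSq.prems by (intro countable_terms_PSq) (auto simp: countable_terms_def acc_coeff_terms_def)
  then have below: "plt x POm" if "x \<in> set as" for x
    using that by (auto simp: countable_terms_def)
  have "x \<in> acc_coeff_terms" if "x \<in> set as" for x
    using PSq.prems(1) that by (auto simp: acc_coeff_terms_def)
  then have "set as \<subseteq> acc_terms" using PSq.IH below by blast
  then show ?case using PSq.prems by (intro PSq_in_acc_terms) (auto simp: acc_coeff_terms_def)
qed (auto simp: acc_coeff_terms_def)

text \<open>Below \<Omega> the term lies in W and its predecessors stay below \<Omega>, so
  accessibility transfers from the countable terms. Then \<Omega> is accessible since all its
  predecessors are, and sequences follow by \<open>PSq_in_acc\<close>.\<close>

lemma acc_coeff_terms_acc: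
  assumes "a \<in> acc_coeff_terms"
  shows "a \<in> Wellfounded.acc (plt_on acc_coeff_terms)"
proof -
  have below: "a \<in> Wellfounded.acc (plt_on acc_coeff_terms)" if "a \<in> acc_coeff_terms" "plt a POm" for a
  proof -
    have "a \<in> Wellfounded.acc (plt_on countable_terms)"
      using acc_coeff_terms_countable that by (simp add: acc_terms_def)
    then show ?thesis using that
    proof (induction rule: acc_induct_rule)
      case (1 a)
      show ?case
      proof (rule accI)
        fix b assume "(b, a) \<in> plt_on acc_coeff_terms"
        then have b: "b \<in> acc_coeff_terms" "plt b a" by (auto simp: plt_on_def)
        then have "plt b POm" using plt_Omega_downward 1 by blast
        then show "b \<in> Wellfounded.acc (plt_on acc_coeff_terms)"
          using 1 b by (auto simp: plt_on_def countable_terms_def acc_coeff_terms_def)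
      qed
    qed
  qed
  show ?thesis using assms
  proof (induction a)
    case POm
    show ?case
    proof (rule accI)
      fix b assume "(b, POm) \<in> plt_on acc_coeff_terms"
      then show "b \<in> Wellfounded.acc (plt_on acc_coeff_terms)"
        by (intro below) (auto simp: plt_on_def)
    qed
  next
    case (PTh a)
    then show ?case by (intro below) auto
  next
    case (PSq as)
    have "set as \<subseteq> acc_coeff_terms" using PSq.prems by (auto simp: acc_coeff_terms_def)
    then show ?case
      using PSq by (intro PSq_in_acc) (auto simp: acc_coeff_terms_def)
  qed
qed

text \<open>The collapsing step. Outer induction runs along the accessible relation on
  \<open>acc_coeff_terms\<close>; an inner induction on size puts every \<open>b\<close> below
  \<open>PTh a\<close> into W. If \<open>b = PTh c\<close>, either the coefficients of
  \<open>c\<close> are below \<open>PTh a\<close>, hence in W, and the outer hypothesis applies to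
  \<open>c\<close>, or \<open>b\<close> is weakly below a coefficient of \<open>a\<close>, which is
  in W.\<close>

lemma PTh_in_acc_terms:
  assumes "a \<in> acc_coeff_terms"
  shows "PTh a \<in> acc_terms"
  using acc_coeff_terms_acc[OF assms] assms
proof (induction rule: acc_induct_rule)
  case (1 a)
  have IH: "PTh b \<in> acc_terms" if "b \<in> acc_coeff_terms" "plt b a" for b
    using 1 that by (auto simp: plt_on_def)
  have below: "b \<in> acc_terms" if "is_ot b" "plt b (PTh a)" for b
    using that
  proof (induction "size b" arbitrary: b rule: less_induct)
    case less
    show ?case
    proof (cases b)
      case (PTh c)
      from less.prems(2) PTh consider
        (smaller) "plt c a" "\<forall>g\<in>pE c. plt g (PTh a)" | (coeff) g where "g \<in> pE a" "ple (PTh c) g"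
        by auto
      then show ?thesis
      proof cases
        case smaller
        have "g \<in> acc_terms" if "g \<in> pE c" for g
          using less.hyps[of g] size_pE[OF that] smaller(2) that less.prems(1) PTh is_ot_pE[OF _ that]
          by auto
        then have "c \<in> acc_coeff_terms" using less.prems(1) PTh by (auto simp: acc_coeff_terms_def)
        then show ?thesis using IH smaller(1) PTh by simp
      next
        case coeff
        then show ?thesis
          using acc_terms_downward[of g b] 1(3) less.prems(1) PTh by (auto simp: acc_coeff_terms_def)
      qed
    next
      case (PSq bs)
      have "set bs \<subseteq> acc_terms"
      proof (cases bs)
        case (Cons x xs)
        have "x \<in> acc_terms"
          using less.hyps[of x] less.prems Cons PSq by auto
        then show ?thesis
          using less.prems(1) PSq Cons acc_terms_downward
          by (intro successively_ple_closed) auto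
      qed simp
      then show ?thesis using PSq_in_acc_terms less.prems(1) PSq by simp
    qed (use less.prems in simp)
  qed
  have "PTh a \<in> Wellfounded.acc (plt_on countable_terms)"
  proof (rule accI)
    fix b assume "(b, PTh a) \<in> plt_on countable_terms"
    then have "b \<in> acc_terms"
      by (intro below) (auto simp: plt_on_def countable_terms_def)
    then show "b \<in> Wellfounded.acc (plt_on countable_terms)" by (simp add: acc_terms_def)
  qed
  then show ?case using 1(3) by (simp add: acc_terms_def countable_terms_def acc_coeff_terms_def)
qed

lemma is_ot_acc_coeff_terms: "is_ot a \<Longrightarrow> a \<in> acc_coeff_terms"
proof (induction a)
  case (PTh a)
  then show ?case using PTh_in_acc_terms[of a] by (simp add: acc_coeff_terms_def)
qed (auto simp: acc_coeff_terms_def)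

lemma wf_less_ot: "wf {(a :: ot, b). a < b}"
proof (rule wfUNIVI)
  fix P :: "ot \<Rightarrow> bool" and x
  assume step: "\<forall>x. (\<forall>y. (y, x) \<in> {(a, b). a < b} \<longrightarrow> P y) \<longrightarrow> P x"
  have "P (Abs_ot a)" if "a \<in> Wellfounded.acc (plt_on acc_coeff_terms)" "is_ot a" for a
    using that
  proof (induction rule: acc_induct_rule)
    case (1 a)
    have "P y" if "y < Abs_ot a" for y
    proof -
      have "is_ot (Rep_ot y)" using Rep_ot by simp
      moreover have "plt (Rep_ot y) a" using that 1 by (simp add: less_ot.rep_eq Abs_ot_inverse)
      ultimately have "(Rep_ot y, a) \<in> plt_on acc_coeff_terms"
        using is_ot_acc_coeff_terms 1 by (auto simp: plt_on_def)
      then have "P (Abs_ot (Rep_ot y))" using 1 \<open>is_ot (Rep_ot y)\<close> by blast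
      then show ?thesis by (simp add: Rep_ot_inverse)
    qed
    then show ?case using step by blast
  qed
  from this[of "Rep_ot x"] show "P x"
    using acc_coeff_terms_acc is_ot_acc_coeff_terms Rep_ot[of x] by (simp add: Rep_ot_inverse)
qed


section \<open>Heights of derivations\<close>

lemma less_ot_irrefl: "\<not> a < (a :: ot)"
  using wf_irrefl[OF wf_less_ot, of a] by simp

lemma is_ot_Rep_ot [simp]: "is_ot (Rep_ot a)"
  using Rep_ot by simp

lemma pE_one_pplus [simp]: "is_ot a \<Longrightarrow> pE (pplus (pfin (Suc 0)) a) = pE a"
  by (auto simp: one_pplus split: preterm.splits)

lemma one_pplus_nonzero: "is_ot a \<Longrightarrow> pplus (pfin (Suc 0)) a \<noteq> PSq []"
  by (auto simp: one_pplus split: preterm.splits)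

lemma one_pplus_inj:
  assumes "is_ot a" "is_ot b" "pplus (pfin (Suc 0)) a = pplus (pfin (Suc 0)) b"
  shows "a = b"
  using assms by (auto simp: one_pplus split: preterm.splits if_splits)

text \<open>Irreflexivity, a consequence of well-foundedness, gives \<open>a \<noteq> b\<close>;
  injectivity then makes the weak monotonicity strict.\<close>

lemma one_pplus_strict_mono:
  assumes "is_ot a" "is_ot b" "plt a b"
  shows "plt (pplus (pfin (Suc 0)) a) (pplus (pfin (Suc 0)) b)"
proof -
  have "a \<noteq> b"
    using less_ot_irrefl[of "Abs_ot a"] assms by (auto simp: less_ot.rep_eq Abs_ot_inverse)
  then show ?thesis using one_pplus_mono[of a b] one_pplus_inj[of a b] assms by auto
qed

lemma one_pplus_le_Omega:
  assumes "is_ot a" "ple a POm"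
  shows "ple (pplus (pfin (Suc 0)) a) POm"
  using one_pplus_mono[of a POm] assms by (simp add: one_pplus)

lemma plt_PSq_hd: "plt a b \<Longrightarrow> plt (PSq (a # as)) (PSq (b # bs))"
  by (rule plt_PSqI[of 0]) auto

lemma plt_PSq_snd: "plt a b \<Longrightarrow> plt (PSq (c # a # as)) (PSq (c # b # bs))"
  by (rule plt_PSqI[of 1]) auto

text \<open>If \<open>a\<close> is itself a nonempty sequence, the induction hypothesis puts its
  first entry below \<open>a\<close>, which decides the comparison at position 0.\<close>

lemma plt_PSq_Cons: "plt a (PSq (a # as))"
proof (induction a arbitrary: as)
  case (PSq bs)
  show ?case
  proof (cases bs)
    case (Cons b cs)
    then have "plt b (PSq (b # cs))" using PSq by simp
    then show ?thesis using Cons by (intro plt_PSqI[of 0]) auto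
  qed simp
qed auto

lemma plt_PSq_append:
  assumes "plt a (PSq bs)"
  shows "plt a (PSq (bs @ cs))"
proof (cases a)
  case (PSq as)
  then have "plt (PSq as) (PSq bs)" using assms by simp
  then show ?thesis unfolding PSq
  proof (cases rule: plt_PSqE)
    case (2 j)
    then show "plt (PSq as) (PSq (bs @ cs))" by (intro plt_PSqI[of j]) (auto simp: nth_append)
  qed auto
qed (use assms in \<open>cases bs; auto\<close>)+

lemma plt_PSq_prefix: "c \<noteq> [] \<Longrightarrow> plt (PSq as) (PSq (as @ c))"
  by (cases c) auto

lemma pplus_append:
  assumes "entries a \<noteq> []" "entries b \<noteq> []" "ple (hd (entries b)) (last (entries a))"
  shows "pplus a b = of_entries (entries a @ entries b)"
proof -
  let ?K = "{k. k \<le> length (entries a) \<and> (k = 0 \<or> ple (hd (entries b)) (entries a ! (k - 1)))}"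
  have "length (entries a) \<in> ?K" using assms by (simp add: last_conv_nth)
  then have "Max ?K = length (entries a)" by (intro Max_eqI) auto
  then show ?thesis using assms by (simp add: pplus_def Let_def)
qed

lemma ple_zero: "ple (PSq []) a"
  using zero_plt by blast

text \<open>\<open>omega_pow \<gamma> k\<close> is \<open>\<omega>\<^bsup>1+\<gamma>\<^esup> + k + 1\<close>; in particular it is \<open>\<Omega> + k + 1\<close> for \<open>\<gamma> = \<Omega>\<close>.\<close>

lift_definition omega_pow :: "ot \<Rightarrow> nat \<Rightarrow> ot" is
  "\<lambda>a k. PSq (pplus (pfin (Suc 0)) a # replicate (Suc k) (PSq []))"
proof -
  fix a k assume a: "is_ot a"
  have "successively (\<lambda>a b. ple b a) (pplus (pfin (Suc 0)) a # replicate (Suc k) (PSq []))"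
    by (auto simp: successively_conv_nth nth_Cons' zero_plt)
  then show "is_ot (PSq (pplus (pfin (Suc 0)) a # replicate (Suc k) (PSq [])))"
    using is_ot_pplus[OF is_ot_pfin a, of "Suc 0"] by simp
qed

lemma omega_pow_mono: "a < b \<Longrightarrow> omega_pow a k < omega_pow b j"
proof transfer
  fix a b k j assume "is_ot a" "is_ot b" "plt a b"
  from one_pplus_strict_mono[OF this]
  show "plt (PSq (pplus (pfin (Suc 0)) a # replicate (Suc k) (PSq [])))
    (PSq (pplus (pfin (Suc 0)) b # replicate (Suc j) (PSq [])))"
    by (intro plt_PSqI[of 0]) auto
qed

lemma plt_replicate_prefix:
  assumes "k < j"
  shows "plt (PSq (as @ replicate k x)) (PSq (as @ replicate j x))"
proof -
  have "as @ replicate j x = (as @ replicate k x) @ replicate (j - k) x"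
    using assms by (simp flip: replicate_add)
  then show ?thesis using plt_PSq_prefix[of "replicate (j - k) x" "as @ replicate k x"] assms by simp
qed

lemma omega_pow_Suc_mono: "k < j \<Longrightarrow> omega_pow a k < omega_pow a j"
  by transfer (use plt_replicate_prefix[of "Suc _" "Suc _" "[_]" "PSq []"] in simp)

text \<open>Provides the side condition \<gamma> \<prec> \<alpha> of rule \<open>Disj\<close>. The
  trailing zeros of \<open>omega_pow\<close> matter when \<open>a\<close> is \<Omega> or some
  \<vartheta>\<beta>, where the power of \<omega> alone would equal \<open>a\<close>.\<close>

lemma less_omega_pow: "a < omega_pow a k"
proof transfer
  fix a k assume a: "is_ot a"
  let ?b = "PSq (pplus (pfin (Suc 0)) a # replicate (Suc k) (PSq []))"
  show "plt a ?b"
  proof (cases "\<exists>c cs. a = PSq (c # cs)")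
    case True
    then obtain c cs where c: "a = PSq (c # cs)" by blast
    have "plt c (pplus (pfin (Suc 0)) a)"
      using a c plt_PSq_Cons[of c cs] zero_plt by (simp add: one_pplus)
    then show ?thesis by (simp only: c plt_PSq_hd)
  next
    case False
    then have "a = PSq [] \<or> is_principal a"
      by (metis is_principal.elims(3) list.exhaust)
    then show ?thesis using a by (cases a) (auto simp: one_pplus)
  qed
qed

lemma fin_less_omega_pow: "fin n < omega_pow a k"
proof transfer
  fix n k a assume a: "is_ot a"
  show "plt (pfin n) (PSq (pplus (pfin (Suc 0)) a # replicate (Suc k) (PSq [])))"
  proof (cases n)
    case (Suc m)
    have "plt (PSq []) (pplus (pfin (Suc 0)) a)" using one_pplus_nonzero a zero_plt by blast
    then show ?thesis unfolding pfin_def Suc by (intro plt_PSqI[of 0]) (auto simp: pfin_def)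
  qed (simp add: pfin_def)
qed

lemma coeffs_omega_pow [simp]: "coeffs (omega_pow a k) = coeffs a"
proof -
  have "pE (Rep_ot (omega_pow a k)) = pE (Rep_ot a)"
    by (simp add: omega_pow.rep_eq)
  then show ?thesis unfolding coeffs_def by simp
qed

lemma coeffs_Omega [simp]: "coeffs Omega = {}"
  by transfer simp

lemma coeffs_fin [simp]: "coeffs (fin n) = {}"
  by transfer (simp add: pfin_def)

section \<open>The bounds \<Omega> + \<omega>^(1+\<gamma>) + k + 1\<close>

definition height :: "ot \<Rightarrow> nat \<Rightarrow> ot" where
  "height a k = Omega + omega_pow a k"

text \<open>Since 1+\<alpha> is at most \<Omega>, the addition absorbs nothing. The second entry
  carries \<alpha>, and comparisons between heights are decided there or in the trailing
  zeros.\<close>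

lemma Rep_height:
  assumes "a \<le> Omega"
  shows "Rep_ot (height a k) =
    PSq (POm # pplus (pfin (Suc 0)) (Rep_ot a) # replicate (Suc k) (PSq []))"
proof -
  have "ple (Rep_ot a) POm"
    using assms by (auto simp: less_eq_ot_def less_ot.rep_eq Omega.rep_eq)
  then have "ple (pplus (pfin (Suc 0)) (Rep_ot a)) POm"
    by (intro one_pplus_le_Omega) auto
  then show ?thesis
    by (simp add: height_def plus_ot.rep_eq Omega.rep_eq omega_pow.rep_eq pplus_append of_entries_def)
qed

lemma height_mono:
  assumes "a < b" "a \<le> Omega" "b \<le> Omega"
  shows "height a k < height b j"
proof -
  have "plt (pplus (pfin (Suc 0)) (Rep_ot a)) (pplus (pfin (Suc 0)) (Rep_ot b))"
    using assms by (intro one_pplus_strict_mono) (auto simp: less_ot.rep_eq)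
  then show ?thesis
    unfolding less_ot.rep_eq Rep_height[OF assms(2)] Rep_height[OF assms(3)]
    by (intro plt_PSqI[of 1]) auto
qed

lemma height_Suc_mono:
  assumes "a \<le> Omega" "k < j"
  shows "height a k < height a j"
  unfolding less_ot.rep_eq Rep_height[OF assms(1)]
  using plt_replicate_prefix[of "Suc k" "Suc j" "[POm, pplus (pfin (Suc 0)) (Rep_ot a)]" "PSq []"] assms
  by simp

lemma fin_less_height:
  assumes "a \<le> Omega"
  shows "fin n < height a k"
  unfolding less_ot.rep_eq Rep_height[OF assms] fin.rep_eq pfin_def
  by (cases n) (simp, simp only: replicate_Suc, rule plt_PSq_hd, simp)

text \<open>The summand \<Omega> of \<open>height\<close> pays for tautologies: the list of \<Omega>
  + k + 1 has second entry 0, against 1+\<alpha>, which is never 0.\<close>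

lemma omega_pow_less_height:
  assumes "a \<le> Omega"
  shows "omega_pow Omega k < height a j"
proof -
  have "plt (PSq []) (pplus (pfin (Suc 0)) (Rep_ot a))"
    using one_pplus_nonzero[of "Rep_ot a"] zero_plt by simp
  then show ?thesis
    unfolding less_ot.rep_eq Rep_height[OF assms] omega_pow.rep_eq Omega.rep_eq
    by (simp only: replicate_Suc one_pplus[OF is_ot.simps(1)[THEN iffD2, OF TrueI]] preterm.case plt_PSq_snd)
qed

lemma coeffs_height [simp]:
  assumes "a \<le> Omega"
  shows "coeffs (height a k) = coeffs a"
proof -
  have "pE (Rep_ot (height a k)) = pE (Rep_ot a)"
    by (simp add: Rep_height[OF assms])
  then show ?thesis unfolding coeffs_def by simp
qed

lemma Rep_height_Omega:
  "Rep_ot (height Omega k) = PSq (POm # POm # replicate (Suc k) (PSq []))"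
  by (simp add: Rep_height less_eq_ot_def Omega.rep_eq one_pplus)

lemma Rep_plus_fin:
  assumes "entries (Rep_ot a) \<noteq> []"
  shows "Rep_ot (a + fin (Suc n)) = PSq (entries (Rep_ot a) @ replicate (Suc n) (PSq []))"
  using assms ple_zero
  by (auto simp: plus_ot.rep_eq fin.rep_eq pfin_def pplus_append of_entries_def)

lemma height_Omega_eq: "height Omega k = Omega + Omega + fin (Suc k)"
proof -
  have "Rep_ot (Omega + Omega) = PSq [POm, POm]"
    by (simp add: plus_ot.rep_eq Omega.rep_eq pplus_append of_entries_def)
  then show ?thesis
    by (simp add: Rep_plus_fin Rep_height_Omega flip: Rep_ot_inject)
qed

lemma Omega_less_height: "Omega < height Omega k"
  by (simp add: less_ot.rep_eq Rep_height_Omega Omega.rep_eq)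

text \<open>The larger bound extends the smaller one as a list, and lying below a sequence survives
  appending entries.\<close>

lemma less_height_Omega_mono:
  assumes "a < height Omega k" "k \<le> j"
  shows "a < height Omega j"
proof -
  have "POm # POm # replicate (Suc j) (PSq []) =
      (POm # POm # replicate (Suc k) (PSq [])) @ replicate (j - k) (PSq [])"
    using assms(2) by (simp flip: replicate_add)
  then show ?thesis
    using assms(1) plt_PSq_append unfolding less_ot.rep_eq Rep_height_Omega by metis
qed

text \<open>A proper initial segment of the list of \<Omega> + k + 1 is also one of the list of
  \<Omega>*2 + j + 1, or it has 0 against \<Omega> at position 1. A first difference must occur at
  the entry \<Omega>, as nothing lies below 0.\<close>

lemma less_omega_pow_Omega:
  assumes "a < omega_pow Omega k"
  shows "a < height Omega j"
proof -
  have lt: "plt (Rep_ot a) (PSq (POm # replicate (Suc k) (PSq [])))"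
    using assms by (simp add: less_ot.rep_eq omega_pow.rep_eq Omega.rep_eq one_pplus)
  have "plt (Rep_ot a) (PSq (POm # POm # replicate (Suc j) (PSq [])))"
  proof (cases "Rep_ot a")
    case (PSq as)
    then have "plt (PSq as) (PSq (POm # replicate (Suc k) (PSq [])))" using lt by simp
    then show ?thesis unfolding PSq
    proof (cases rule: plt_PSqE)
      case (1 c cs)
      then show "plt (PSq as) (PSq (POm # POm # replicate (Suc j) (PSq [])))"
      proof (cases as)
        case (Cons x xs)
        show ?thesis
        proof (cases xs)
          case (Cons y ys)
          then have "x = POm" "y = PSq []"
            using 1 \<open>as = x # xs\<close> by (auto simp: Cons_eq_append_conv)
          then show ?thesis
            using Cons \<open>as = x # xs\<close> by (intro plt_PSqI[of 1]) auto
        qed (use 1 Cons in auto)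
      qed simp
    next
      case (2 i)
      show "plt (PSq as) (PSq (POm # POm # replicate (Suc j) (PSq [])))"
      proof (cases i)
        case 0
        then show ?thesis using 2 by (intro plt_PSqI[of 0]) auto
      next
        case (Suc i')
        then have "plt (as ! i) (PSq [])" using 2 by (simp add: nth_Cons' split: if_splits)
        then show ?thesis using not_plt_zero by blast
      qed
    qed
  qed (use lt in auto)
  then show ?thesis by (simp add: less_ot.rep_eq Rep_height_Omega)
qed

section \<open>Terms below \<Omega>, 2 and \<omega>\<close>

lemma less_Omega_downward: "a < b \<Longrightarrow> b \<le> Omega \<Longrightarrow> a < Omega"
  unfolding less_eq_ot_def
  by (metis Omega.rep_eq less_ot.rep_eq plt_Omega_downward)

lemma not_less_fin_0: "\<not> a < fin 0"
  by transfer (simp add: pfin_def not_plt_zero)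

lemma fin_inject [simp]: "fin m = fin n \<longleftrightarrow> m = n"
  by transfer (simp add: pfin_def)

lemma less_fin_2:
  assumes "a < fin 2"
  shows "a = fin 0 \<or> a = fin 1"
  using assms
proof transfer
  fix a assume a: "plt a (pfin 2)"
  have two: "pfin 2 = PSq [PSq [], PSq []]" by (simp add: pfin_def numeral_eq_Suc)
  show "a = pfin 0 \<or> a = pfin 1"
  proof (cases a)
    case (PSq as)
    then have "plt (PSq as) (PSq [PSq [], PSq []])" using a two by simp
    then show ?thesis
    proof (cases rule: plt_PSqE)
      case 1
      then show ?thesis using PSq by (auto simp: pfin_def Cons_eq_append_conv)
    next
      case (2 j)
      then show ?thesis by (cases j) (auto simp: not_plt_zero)
    qed
  qed (use a two in auto)
qed

lemma fin_less_fin: "m < n \<Longrightarrow> fin m < fin n"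
  using plt_replicate_prefix[of m n "[]" "PSq []"]
  by (simp add: less_ot.rep_eq fin.rep_eq pfin_def)

lemma fin_less_omega: "fin n < omega"
  by transfer (cases n; auto simp: pfin_def intro: plt_PSqI[of 0])

text \<open>Rule \<open>Conj\<close> ranges over all terms below \<omega>; that these are numerals
  makes it the \<omega>-rule. The first entry of such a term is below 1, hence 0, and then so are
  the others, as the sequence decreases.\<close>

lemma less_omega:
  assumes "a < omega"
  shows "\<exists>n. a = fin n"
  using assms
proof transfer
  fix a assume ot: "is_ot a" and a: "plt a (PSq [pfin 1])"
  show "\<exists>n. a = pfin n"
  proof (cases a)
    case (PSq as)
    show ?thesis
    proof (cases as)
      case Nil
      then show ?thesis using PSq by (auto simp: pfin_def intro: exI[of _ 0])
    next
      case (Cons x xs)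
      have "plt (PSq as) (PSq [pfin 1])" using a PSq by simp
      then have "plt x (PSq [PSq []])"
      proof (cases rule: plt_PSqE)
        case (2 j)
        then show ?thesis using Cons by (simp add: pfin_def)
      qed (use Cons in \<open>auto simp: Cons_eq_append_conv\<close>)
      then have "x = PSq []"
      proof (cases x)
        case (PSq ys)
        then have "plt (PSq ys) (PSq [PSq []])" using \<open>plt x (PSq [PSq []])\<close> by simp
        then show ?thesis
        proof (cases rule: plt_PSqE)
          case 1
          then show ?thesis using PSq by (auto simp: Cons_eq_append_conv)
        qed (auto simp: not_plt_zero)
      qed auto
      then have "set as \<subseteq> {PSq []}"
        using Cons ot PSq not_plt_zero by (intro successively_ple_closed) auto
      then have "as = replicate (length as) (PSq [])"
        by (intro replicate_eqI) auto
      then show ?thesis using PSq by (auto simp: pfin_def)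
    qed
  qed (use a in \<open>auto simp: pfin_def\<close>)
qed


section \<open>Substitution\<close>

lemma neg_neg [simp]: "neg (neg A) = A"
  by (induction A) auto

lemma preds_neg [simp]: "preds (neg A) = preds A"
  by (induction A) auto

lemma fv_neg [simp]: "fv (neg A) = fv A"
  by (induction A) auto

lemma preds_subst [simp]: "preds (subst \<sigma> A) = preds A"
  by (induction A arbitrary: \<sigma>) auto

lemma subst_neg: "subst \<sigma> (neg A) = neg (subst \<sigma> A)"
  by (induction A arbitrary: \<sigma>) auto

lemma rk_subst [simp]: "rk (subst \<sigma> A) = rk A"
  by (induction A arbitrary: \<sigma>) auto

lemma map_preds_subst: "map_preds f (subst \<sigma> A) = subst \<sigma> (map_preds f A)"
  by (induction A arbitrary: \<sigma>) auto

lemma map_preds_neg: "map_preds f (neg A) = neg (map_preds f A)"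
  by (induction A) auto

lemma fv_map_preds [simp]: "fv (map_preds f A) = fv A"
  by (induction A) auto

lemma subst_tm_subst_tm: "subst_tm \<tau> (subst_tm \<sigma> t) = subst_tm (\<lambda>i. subst_tm \<tau> (\<sigma> i)) t"
  by (induction t) auto

lemma subst_tm_cong: "(\<And>i. i \<in> fv_tm t \<Longrightarrow> \<sigma> i = \<tau> i) \<Longrightarrow> subst_tm \<sigma> t = subst_tm \<tau> t"
  by (induction t) auto

lemma subst_tm_Var [simp]: "subst_tm Var t = t"
  by (induction t) auto

lemma fv_subst_tm: "fv_tm (subst_tm \<sigma> t) = (\<Union>i\<in>fv_tm t. fv_tm (\<sigma> i))"
  by (induction t) auto

lemma up_0 [simp]: "up \<sigma> 0 = Var 0"
  and up_Suc [simp]: "up \<sigma> (Suc i) = subst_tm (\<lambda>j. Var (Suc j)) (\<sigma> i)"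
  by (simp_all add: up_def)

lemma subst_tm_up: "(\<lambda>i. subst_tm (up \<tau>) (up \<sigma> i)) = up (\<lambda>i. subst_tm \<tau> (\<sigma> i))"
proof
  fix i show "subst_tm (up \<tau>) (up \<sigma> i) = up (\<lambda>i. subst_tm \<tau> (\<sigma> i)) i"
    by (cases i) (auto simp: subst_tm_subst_tm)
qed

lemma subst_subst: "subst \<tau> (subst \<sigma> A) = subst (\<lambda>i. subst_tm \<tau> (\<sigma> i)) A"
  by (induction A arbitrary: \<sigma> \<tau>) (auto simp: subst_tm_subst_tm subst_tm_up)

lemma subst_cong: "(\<And>i. i \<in> fv A \<Longrightarrow> \<sigma> i = \<tau> i) \<Longrightarrow> subst \<sigma> A = subst \<tau> A"
proof (induction A arbitrary: \<sigma> \<tau>)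
  case (All A)
  have "up \<sigma> i = up \<tau> i" if "i \<in> fv A" for i using All.prems that by (cases i) auto
  then show ?case using All.IH[of "up \<sigma>" "up \<tau>"] by simp
next
  case (Ex A)
  have "up \<sigma> i = up \<tau> i" if "i \<in> fv A" for i using Ex.prems that by (cases i) auto
  then show ?case using Ex.IH[of "up \<sigma>" "up \<tau>"] by simp
next
  case (And A B)
  have "subst \<sigma> A = subst \<tau> A" "subst \<sigma> B = subst \<tau> B"
    using And.prems by (auto intro!: And.IH)
  then show ?case by simp
next
  case (Or A B)
  have "subst \<sigma> A = subst \<tau> A" "subst \<sigma> B = subst \<tau> B"
    using Or.prems by (auto intro!: Or.IH)
  then show ?case by simp
qed (auto intro!: subst_tm_cong)

lemma up_Var: "up Var = Var"
proof
  fix i show "up Var i = Var i" by (cases i) auto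
qed

lemma subst_Var [simp]: "subst Var A = A"
  by (induction A) (auto simp: up_Var)

lemma fv_tm_up: "(Suc i \<in> fv_tm (up \<sigma> j)) = (\<exists>k. j = Suc k \<and> i \<in> fv_tm (\<sigma> k))"
  by (cases j) (auto simp: fv_subst_tm)

lemma fv_subst: "fv (subst \<sigma> A) = (\<Union>i\<in>fv A. fv_tm (\<sigma> i))"
  by (induction A arbitrary: \<sigma>) (auto simp: fv_subst_tm fv_tm_up)

section \<open>Closing substitutions and values of terms\<close>

definition closing :: "(nat \<Rightarrow> tm) \<Rightarrow> bool" where
  "closing \<sigma> \<longleftrightarrow> (\<forall>i. fv_tm (\<sigma> i) = {})"

lemma closing_case_nat [intro]: "closing \<sigma> \<Longrightarrow> fv_tm t = {} \<Longrightarrow> closing (case_nat t \<sigma>)"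
  by (auto simp: closing_def split: nat.split)

lemma fv_subst_tm_closing [simp]: "closing \<sigma> \<Longrightarrow> fv_tm (subst_tm \<sigma> t) = {}"
  by (simp add: fv_subst_tm closing_def)

lemma fv_subst_closing [simp]: "closing \<sigma> \<Longrightarrow> fv (subst \<sigma> A) = {}"
  by (simp add: fv_subst closing_def)

lemma fv_num [simp]: "fv_tm (num n) = {}"
  by (induction n) auto

lemma tval_num [simp]: "tval (num n) = n"
  by (induction n) auto

lemma tval_subst_tm:
  "(\<And>i. tval (\<sigma> i) = tval (\<tau> i)) \<Longrightarrow> tval (subst_tm \<sigma> t) = tval (subst_tm \<tau> t)"
  by (induction t) auto

text \<open>Quantifier instances arise in this form: the term for the bound variable is absorbed
  into the closing substitution.\<close>

lemma inst_subst_up: "inst (subst (up \<sigma>) A) t = subst (case_nat t \<sigma>) A"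
proof -
  have "(\<lambda>i. subst_tm (case_nat t Var) (up \<sigma> i)) = case_nat t \<sigma>"
  proof
    fix i show "subst_tm (case_nat t Var) (up \<sigma> i) = case_nat t \<sigma> i"
      by (cases i) (auto simp: subst_tm_subst_tm)
  qed
  then show ?thesis by (simp add: inst_def subst_subst)
qed

lemma subst_inst: "subst \<sigma> (inst A t) = subst (case_nat (subst_tm \<sigma> t) \<sigma>) A"
proof -
  have "(\<lambda>i. subst_tm \<sigma> (case_nat t Var i)) = case_nat (subst_tm \<sigma> t) \<sigma>"
    by (auto split: nat.split)
  then show ?thesis by (simp add: inst_def subst_subst)
qed

lemma subst_repl:
  "subst \<sigma> (repl A t) = subst (case_nat (subst_tm \<sigma> t) (\<lambda>i. \<sigma> (Suc i))) A"
proof -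
  have "(\<lambda>i. subst_tm \<sigma> (case_nat t (\<lambda>i. Var (Suc i)) i)) = case_nat (subst_tm \<sigma> t) (\<lambda>i. \<sigma> (Suc i))"
    by (auto split: nat.split)
  then show ?thesis by (simp add: repl_def subst_subst)
qed

lemma subst_shift: "subst (case_nat t \<sigma>) (shift A) = subst \<sigma> A"
  by (simp add: shift_def subst_subst)

lemma fv_with_pred: "fv (with_pred \<phi> P) \<subseteq> {0}"
  using form_of[of \<phi>] by (simp add: with_pred_def)

lemma positive_form_of: "positive (form_of \<phi>)"
  using form_of[of \<phi>] by simp

lemma preds_with_pred: "preds (with_pred \<phi> P) \<subseteq> {P}"
  by (auto simp: with_pred_def fm.set_map)

text \<open>An operator form has no variable besides index 0, so the tail of the substitution may be
  chosen to match the context.\<close>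

lemma inst_with_pred: "inst (with_pred \<phi> P) t = subst (case_nat t \<sigma>) (with_pred \<phi> P)"
  unfolding inst_def using fv_with_pred[of \<phi> P] by (intro subst_cong) (auto split: nat.split)

section \<open>The translation into the infinitary language and its parameters\<close>

lemma plus_fm_simps [simp]:
  "plus_fm (Eq s t) = Eq s t" "plus_fm (Neq s t) = Neq s t"
  "plus_fm (Pos \<phi> t) = Pos (\<phi>, Omega) t" "plus_fm (Neg \<phi> t) = Neg (\<phi>, Omega) t"
  "plus_fm (And A B) = And (plus_fm A) (plus_fm B)" "plus_fm (Or A B) = Or (plus_fm A) (plus_fm B)"
  "plus_fm (All A) = All (plus_fm A)" "plus_fm (Ex A) = Ex (plus_fm A)"
  by (simp_all add: plus_fm_def)

lemma plus_fm_neg: "plus_fm (neg A) = neg (plus_fm A)"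
  by (simp add: plus_fm_def map_preds_neg)

lemma plus_fm_subst: "plus_fm (subst \<sigma> A) = subst \<sigma> (plus_fm A)"
  by (simp add: plus_fm_def map_preds_subst)

lemma plus_fm_inst: "plus_fm (inst A t) = inst (plus_fm A) t"
  by (simp add: inst_def plus_fm_subst)

lemma plus_fm_repl: "plus_fm (repl A t) = repl (plus_fm A) t"
  by (simp add: repl_def plus_fm_subst)

lemma plus_fm_with_pred: "plus_fm (with_pred \<phi> \<phi>) = with_pred \<phi> (\<phi>, Omega)"
  by (simp add: plus_fm_def with_pred_def fm.map_comp comp_def)

lemma plus_fm_with_fm: "plus_fm (with_fm C A) = with_fm C (plus_fm A)"
  by (induction C arbitrary: A) (auto simp: plus_fm_repl plus_fm_neg plus_fm_subst)

lemma params_plus_fm: "params (plus_fm A) \<subseteq> {Omega}"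
  by (auto simp: params_def plus_fm_def fm.set_map)

lemma params_neg [simp]: "params (neg A) = params A"
  by (simp add: params_def)

lemma params_subst [simp]: "params (subst \<sigma> A) = params A"
  by (simp add: params_def)

lemma params_inst [simp]: "params (inst A t) = params A"
  by (simp add: inst_def)

lemma params_simps [simp]:
  "params (Eq s t) = {}" "params (Neq s t) = {}"
  "params (Pos P t) = {snd P}" "params (Neg P t) = {snd P}"
  "params (And A B) = params A \<union> params B" "params (Or A B) = params A \<union> params B"
  "params (All A) = params A" "params (Ex A) = params A"
  by (auto simp: params_def)

lemma params_with_pred: "params (with_pred \<phi> (\<phi>, \<gamma>)) \<subseteq> {\<gamma>}"
  using preds_with_pred[of \<phi> "(\<phi>, \<gamma>)"] by (auto simp: params_def)


section \<open>Derived rules of the infinitary system\<close>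

lemma niceD:
  assumes "nice H"
  shows "X \<subseteq> H X" "X \<subseteq> H Y \<Longrightarrow> H X \<subseteq> H Y" "\<alpha> \<in> H X \<longleftrightarrow> coeffs \<alpha> \<subseteq> H X"
  using assms by (simp_all add: nice_def)

lemma nice_relativize:
  assumes "nice H"
  shows "nice (relativize H Z)"
  unfolding nice_def relativize_def
proof (intro conjI allI impI)
  fix X Y
  show "X \<subseteq> H (Z \<union> X)" using niceD(1)[OF assms] by blast
  show "H (Z \<union> X) \<subseteq> H (Z \<union> Y)" if "X \<subseteq> H (Z \<union> Y)"
    using that niceD(1)[OF assms, of "Z \<union> Y"] by - (rule niceD(2)[OF assms], auto)
  show "\<alpha> \<in> H (Z \<union> X) \<longleftrightarrow> coeffs \<alpha> \<subseteq> H (Z \<union> X)" for \<alpha> using niceD(3)[OF assms] .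
qed

text \<open>Numerals belong to every \<open>H {}\<close>, so the premises for conjunctions and
  number quantifiers live over the same operator.\<close>

lemma relativize_trivial:
  assumes "nice H" "\<gamma> \<in> H {}"
  shows "relativize H {\<gamma>} = H"
proof
  fix X
  have "H {} \<subseteq> H X" using assms(1) by - (rule niceD(2)[OF assms(1)], auto)
  then have "H ({\<gamma>} \<union> X) \<subseteq> H X"
    using assms niceD(1)[OF assms(1), of X] by - (rule niceD(2)[OF assms(1)], auto)
  moreover have "H X \<subseteq> H ({\<gamma>} \<union> X)"
    using niceD(1)[OF assms(1), of "{\<gamma>} \<union> X"] by - (rule niceD(2)[OF assms(1)], auto)
  ultimately show "relativize H {\<gamma>} X = H X" by (auto simp: relativize_def)
qed

lemma relativize_mono: "nice H \<Longrightarrow> H {} \<subseteq> relativize H {\<gamma>} {}"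
  unfolding relativize_def by (rule niceD(2)) auto

lemma relativize_self: "nice H \<Longrightarrow> \<gamma> \<in> relativize H {\<gamma>} {}"
  unfolding relativize_def using niceD(1)[of H "{\<gamma>}"] by auto

lemma fin_in_nice [simp]: "nice H \<Longrightarrow> fin n \<in> H {}"
  using niceD(3)[of H "fin n"] by simp

lemma Omega_in_nice [simp]: "nice H \<Longrightarrow> Omega \<in> H {}"
  using niceD(3)[of H Omega] by simp

lemma omega_pow_in_nice [simp]: "nice H \<Longrightarrow> \<gamma> \<in> H {} \<Longrightarrow> omega_pow \<gamma> k \<in> H {}"
  using niceD(3)[of H "omega_pow \<gamma> k"] niceD(3)[of H \<gamma>] by simp

lemma height_in_nice [simp]: "nice H \<Longrightarrow> \<gamma> \<le> Omega \<Longrightarrow> \<gamma> \<in> H {} \<Longrightarrow> height \<gamma> k \<in> H {}"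
  using niceD(3)[of H "height \<gamma> k"] niceD(3)[of H \<gamma>] by simp

lemma Omega_le_Omega [simp]: "Omega \<le> Omega"
  by (simp add: less_eq_ot_def)

section \<open>Inference rules for admissible sequents\<close>

definition admissible :: "(ot set \<Rightarrow> ot set) \<Rightarrow> inf_fm set \<Rightarrow> bool" where
  "admissible H \<Gamma> \<longleftrightarrow> sequent \<Gamma> \<and> (\<Union>A\<in>\<Gamma>. params A) \<subseteq> H {}"

text \<open>Derivability up to the well-formedness of the sequent, which all rules below propagate upwards.\<close>

definition der :: "(ot set \<Rightarrow> ot set) \<Rightarrow> ot \<Rightarrow> ot \<Rightarrow> inf_fm set \<Rightarrow> bool" where
  "der H \<alpha> \<rho> \<Gamma> \<longleftrightarrow> (admissible H \<Gamma> \<longrightarrow> derivation H \<alpha> \<rho> \<Gamma>)"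

lemma controlled_iff: "controlled H \<alpha> \<Gamma> \<longleftrightarrow> \<alpha> \<in> H {} \<and> admissible H \<Gamma>"
  by (auto simp: controlled_def admissible_def)

lemma admissible_insert:
  "admissible H (insert A \<Gamma>) \<longleftrightarrow>
    fv A = {} \<and> (\<forall>\<alpha>\<in>params A. \<alpha> \<le> Omega) \<and> params A \<subseteq> H {} \<and> admissible H \<Gamma>"
  by (auto simp: admissible_def sequent_def inf_sentence_def sentence_def)

lemma admissibleD:
  assumes "admissible H \<Gamma>" "A \<in> \<Gamma>"
  shows "fv A = {}" "\<forall>\<alpha>\<in>params A. \<alpha> \<le> Omega" "params A \<subseteq> H {}"
  using assms by (auto simp: admissible_def sequent_def inf_sentence_def sentence_def)

lemma admissible_relativize:
  "nice H \<Longrightarrow> admissible H \<Gamma> \<Longrightarrow> admissible (relativize H {\<gamma>}) \<Gamma>"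
  using relativize_mono by (fastforce simp: admissible_def)

lemma fv_inst_sentence:
  assumes "fv A \<subseteq> {0}" "fv_tm t = {}"
  shows "fv (inst A t) = {}"
  using assms unfolding inst_def fv_subst by (auto split: nat.split)

lemma der_Conj:
  assumes "nice H" "\<alpha> \<in> H {}" "A \<in> \<Gamma>" "is_conj A \<delta> F"
    and "\<And>\<gamma>. \<gamma> < \<delta> \<Longrightarrow> admissible H \<Gamma> \<Longrightarrow> admissible (relativize H {\<gamma>}) (insert (F \<gamma>) \<Gamma>)"
    and "\<And>\<gamma>. \<gamma> < \<delta> \<Longrightarrow> \<exists>\<alpha>'<\<alpha>. der (relativize H {\<gamma>}) \<alpha>' \<rho> (insert (F \<gamma>) \<Gamma>)"
  shows "der H \<alpha> \<rho> \<Gamma>"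
  unfolding der_def
proof
  assume "admissible H \<Gamma>"
  then have "\<forall>\<gamma><\<delta>. \<exists>\<alpha>'<\<alpha>. derivation (relativize H {\<gamma>}) \<alpha>' \<rho> (\<Gamma> \<union> {F \<gamma>})"
    using assms(5,6) unfolding der_def by simp
  then show "derivation H \<alpha> \<rho> \<Gamma>"
    using derivation.Conj assms \<open>admissible H \<Gamma>\<close> by (auto simp: controlled_iff)
qed

lemma der_Disj:
  assumes "nice H" "\<alpha> \<in> H {}" "A \<in> \<Gamma>" "is_disj A \<delta> F" "\<gamma> < \<delta>" "\<gamma> < \<alpha>" "\<gamma> \<in> H {}" "\<alpha>' < \<alpha>"
    and "admissible H \<Gamma> \<Longrightarrow> admissible H (insert (F \<gamma>) \<Gamma>)"
    and "der H \<alpha>' \<rho> (insert (F \<gamma>) \<Gamma>)"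
  shows "der H \<alpha> \<rho> \<Gamma>"
  using derivation.Disj[of H \<alpha> \<Gamma> A \<delta> F \<gamma> \<alpha>' \<rho>] assms
  unfolding der_def by (auto simp: controlled_iff)

lemma der_And:
  assumes "nice H" "\<alpha> \<in> H {}" "And A B \<in> \<Gamma>" "\<alpha>1 < \<alpha>" "\<alpha>2 < \<alpha>"
    and "der H \<alpha>1 \<rho> (insert A \<Gamma>)" "der H \<alpha>2 \<rho> (insert B \<Gamma>)"
  shows "der H \<alpha> \<rho> \<Gamma>"
proof (rule der_Conj[OF assms(1-3)])
  \<comment> \<open>\<open>is_conj\<close> is given through negated disjunctions, so
    \<open>And A B\<close> is presented as the negation of
    \<open>Or (neg A) (neg B)\<close>.\<close>
  let ?F = "\<lambda>\<gamma>. if \<gamma> = fin 0 then neg A else neg B"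
  have "is_disj (Or (neg A) (neg B)) (fin 2) ?F" by (rule is_disj.Or) auto
  from is_conj.intros[OF this] show "is_conj (And A B) (fin 2) (\<lambda>\<gamma>. neg (?F \<gamma>))" by simp
  fix \<gamma> assume \<gamma>: "\<gamma> < fin 2"
  then have \<gamma>': "\<gamma> = fin 0 \<or> \<gamma> = fin 1" by (rule less_fin_2)
  then have rel: "relativize H {\<gamma>} = H" using assms(1) by (intro relativize_trivial) auto
  show "\<exists>\<alpha>'<\<alpha>. der (relativize H {\<gamma>}) \<alpha>' \<rho> (insert (neg (?F \<gamma>)) \<Gamma>)"
    unfolding rel using \<gamma>' assms by auto
  show "admissible (relativize H {\<gamma>}) (insert (neg (?F \<gamma>)) \<Gamma>)" if "admissible H \<Gamma>"
    unfolding rel using that admissibleD[OF that assms(3)] by (auto simp: admissible_insert)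
qed

lemma der_Or1:
  assumes "nice H" "\<alpha> \<in> H {}" "Or A B \<in> \<Gamma>" "fin 0 < \<alpha>" "\<alpha>' < \<alpha>" "der H \<alpha>' \<rho> (insert A \<Gamma>)"
  shows "der H \<alpha> \<rho> \<Gamma>"
proof (rule der_Disj[OF assms(1-3)])
  show "is_disj (Or A B) (fin 2) (\<lambda>\<gamma>. if \<gamma> = fin 0 then A else B)" by (rule is_disj.Or) auto
  show "admissible H (insert (if fin 0 = fin 0 then A else B) \<Gamma>)" if "admissible H \<Gamma>"
    using that admissibleD[OF that assms(3)] by (auto simp: admissible_insert)
qed (use assms in \<open>auto intro: fin_less_fin\<close>)

lemma der_Or2:
  assumes "nice H" "\<alpha> \<in> H {}" "Or A B \<in> \<Gamma>" "fin 1 < \<alpha>" "\<alpha>' < \<alpha>" "der H \<alpha>' \<rho> (insert B \<Gamma>)"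
  shows "der H \<alpha> \<rho> \<Gamma>"
proof (rule der_Disj[OF assms(1-3)])
  show "is_disj (Or A B) (fin 2) (\<lambda>\<gamma>. if \<gamma> = fin 0 then A else B)" by (rule is_disj.Or) auto
  show "admissible H (insert (if fin 1 = fin 0 then A else B) \<Gamma>)" if "admissible H \<Gamma>"
    using that admissibleD[OF that assms(3)] by (auto simp: admissible_insert)
qed (use assms in \<open>auto intro: fin_less_fin\<close>)

lemma der_All:
  assumes "nice H" "\<alpha> \<in> H {}" "All A \<in> \<Gamma>"
    and "\<And>n. \<exists>\<alpha>'<\<alpha>. der H \<alpha>' \<rho> (insert (inst A (num n)) \<Gamma>)"
  shows "der H \<alpha> \<rho> \<Gamma>"
proof (rule der_Conj[OF assms(1-3)])
  \<comment> \<open>The definite description decodes the index \<gamma> into its number; the family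
    is unconstrained at terms that are not numerals.\<close>
  let ?F = "\<lambda>\<gamma>. inst (neg A) (num (THE n. \<gamma> = fin n))"
  have "is_disj (Ex (neg A)) omega ?F" by (rule is_disj.Ex) auto
  from is_conj.intros[OF this] show "is_conj (All A) omega (\<lambda>\<gamma>. neg (?F \<gamma>))" by simp
  fix \<gamma> assume "\<gamma> < omega"
  then obtain n where n: "\<gamma> = fin n" using less_omega by blast
  then have rel: "relativize H {\<gamma>} = H" using assms(1) by (intro relativize_trivial) auto
  have F: "neg (?F \<gamma>) = inst A (num n)" by (simp add: n inst_def subst_neg)
  show "\<exists>\<alpha>'<\<alpha>. der (relativize H {\<gamma>}) \<alpha>' \<rho> (insert (neg (?F \<gamma>)) \<Gamma>)"
    unfolding rel F using assms(4) .
  show "admissible (relativize H {\<gamma>}) (insert (neg (?F \<gamma>)) \<Gamma>)" if "admissible H \<Gamma>"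
  proof -
    have "fv A \<subseteq> {0}" using admissibleD(1)[OF that assms(3)] by (auto, metis not0_implies_Suc)
    then show ?thesis
      unfolding rel F using that admissibleD[OF that assms(3)]
      by (auto simp: admissible_insert fv_inst_sentence)
  qed
qed

lemma der_Ex:
  assumes "nice H" "\<alpha> \<in> H {}" "Ex A \<in> \<Gamma>" "fin n < \<alpha>" "\<alpha>' < \<alpha>"
    and "der H \<alpha>' \<rho> (insert (inst A (num n)) \<Gamma>)"
  shows "der H \<alpha> \<rho> \<Gamma>"
proof (rule der_Disj[OF assms(1-3)])
  let ?F = "\<lambda>\<gamma>. inst A (num (THE n. \<gamma> = fin n))"
  show "is_disj (Ex A) omega ?F" by (rule is_disj.Ex) auto
  show "admissible H (insert (?F (fin n)) \<Gamma>)" if "admissible H \<Gamma>"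
  proof -
    have "fv A \<subseteq> {0}" using admissibleD(1)[OF that assms(3)] by (auto, metis not0_implies_Suc)
    then show ?thesis
      using that admissibleD[OF that assms(3)] by (auto simp: admissible_insert fv_inst_sentence)
  qed
qed (use assms fin_less_omega in auto)

lemma der_true_Eq:
  assumes "nice H" "\<alpha> \<in> H {}" "Eq s t \<in> \<Gamma>" "tval s = tval t"
  shows "der H \<alpha> \<rho> \<Gamma>"
  using is_conj.intros[OF is_disj.false_Neq[OF assms(4)]] not_less_fin_0
  by (intro der_Conj[OF assms(1-3)]) auto

lemma der_true_Neq:
  assumes "nice H" "\<alpha> \<in> H {}" "Neq s t \<in> \<Gamma>" "tval s \<noteq> tval t"
  shows "der H \<alpha> \<rho> \<Gamma>"
  using is_conj.intros[OF is_disj.false_Eq[OF assms(4)]] not_less_fin_0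
  by (intro der_Conj[OF assms(1-3)]) auto

lemma admissible_stage:
  assumes "nice H" "\<gamma> \<in> H {}" "\<gamma> \<le> Omega" "fv_tm t = {}" "admissible H \<Gamma>"
  shows "admissible H (insert (inst (with_pred \<phi> (\<phi>, \<gamma>)) t) \<Gamma>)"
  using assms params_with_pred[of \<phi> \<gamma>]
  by (auto simp: admissible_insert fv_inst_sentence[OF fv_with_pred])

lemma der_Pos:
  assumes "nice H" "\<alpha> \<in> H {}" "Pos (\<phi>, \<delta>) t \<in> \<Gamma>" "\<gamma> < \<delta>" "\<gamma> < \<alpha>" "\<gamma> \<in> H {}" "\<alpha>' < \<alpha>"
    and "der H \<alpha>' \<rho> (insert (inst (with_pred \<phi> (\<phi>, \<gamma>)) t) \<Gamma>)"
  shows "der H \<alpha> \<rho> \<Gamma>"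
proof (rule der_Disj[OF assms(1-3) is_disj.Pos assms(4-7) _ assms(8)])
  assume adm: "admissible H \<Gamma>"
  have "\<gamma> \<le> Omega"
    using admissibleD(2)[OF adm assms(3)] less_Omega_downward[OF assms(4)] by (simp add: less_eq_ot_def)
  then show "admissible H (insert (inst (with_pred \<phi> (\<phi>, \<gamma>)) t) \<Gamma>)"
    using admissibleD(1)[OF adm assms(3)] assms(1,6) adm by (intro admissible_stage) auto
qed

lemma der_Neg:
  assumes "nice H" "\<alpha> \<in> H {}" "Neg (\<phi>, \<delta>) t \<in> \<Gamma>"
    and "\<And>\<gamma>. \<gamma> < \<delta> \<Longrightarrow>
      \<exists>\<alpha>'<\<alpha>. der (relativize H {\<gamma>}) \<alpha>' \<rho> (insert (neg (inst (with_pred \<phi> (\<phi>, \<gamma>)) t)) \<Gamma>)"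
  shows "der H \<alpha> \<rho> \<Gamma>"
proof (rule der_Conj[OF assms(1-3) _ _ assms(4)])
  show "is_conj (Neg (\<phi>, \<delta>) t) \<delta> (\<lambda>\<gamma>. neg (inst (with_pred \<phi> (\<phi>, \<gamma>)) t))"
    using is_conj.intros[OF is_disj.Pos] by force
  fix \<gamma> assume \<gamma>: "\<gamma> < \<delta>" and adm: "admissible H \<Gamma>"
  have "\<gamma> \<le> Omega"
    using admissibleD(2)[OF adm assms(3)] less_Omega_downward[OF \<gamma>] by (simp add: less_eq_ot_def)
  then have "admissible (relativize H {\<gamma>}) (insert (inst (with_pred \<phi> (\<phi>, \<gamma>)) t) \<Gamma>)"
    using admissibleD(1)[OF adm assms(3)] assms(1)
    by (intro admissible_stage nice_relativize relativize_self admissible_relativize adm) auto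
  then show "admissible (relativize H {\<gamma>}) (insert (neg (inst (with_pred \<phi> (\<phi>, \<gamma>)) t)) \<Gamma>)"
    by (simp add: admissible_insert)
qed

lemma der_Cut:
  assumes "nice H" "\<alpha> \<in> H {}" "fv A = {}" "params A \<subseteq> {Omega}" "rk A < \<rho>" "\<alpha>' < \<alpha>"
    and "der H \<alpha>' \<rho> (insert A \<Gamma>)" "der H \<alpha>' \<rho> (insert (neg A) \<Gamma>)"
  shows "der H \<alpha> \<rho> \<Gamma>"
  unfolding der_def
proof
  assume adm: "admissible H \<Gamma>"
  have "\<forall>\<beta>\<in>params A. \<beta> \<le> Omega" "params A \<subseteq> H {}" using assms by auto
  then have "inf_sentence A" "admissible H (insert A \<Gamma>)" "admissible H (insert (neg A) \<Gamma>)"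
    using adm assms(3) by (auto simp: admissible_insert inf_sentence_def sentence_def)
  then show "derivation H \<alpha> \<rho> \<Gamma>"
    using derivation.Cut[of H \<alpha> \<Gamma> A \<rho> \<alpha>'] assms adm by (auto simp: controlled_iff der_def)
qed

lemma der_Fix:
  assumes "nice H" "\<alpha> \<in> H {}" "Omega \<le> \<alpha>" "Pos (\<phi>, Omega) t \<in> \<Gamma>" "\<alpha>' < \<alpha>"
    and "der H \<alpha>' \<rho> (insert (inst (with_pred \<phi> (\<phi>, Omega)) t) \<Gamma>)"
  shows "der H \<alpha> \<rho> \<Gamma>"
  unfolding der_def
proof
  assume adm: "admissible H \<Gamma>"
  then have "admissible H (insert (inst (with_pred \<phi> (\<phi>, Omega)) t) \<Gamma>)"
    using admissibleD(1)[OF adm assms(4)] assms(1) by (intro admissible_stage) auto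
  then show "derivation H \<alpha> \<rho> \<Gamma>"
    using derivation.Fix[of H \<alpha> \<Gamma> \<phi> t \<alpha>' \<rho>] assms adm by (auto simp: controlled_iff der_def)
qed

text \<open>Only the last inference is repeated with the new height, its premises stay untouched.
  Hence it suffices that predecessors of \<alpha> are predecessors of \<beta>;
  \<open>Omega \<le> \<beta>\<close> keeps \<open>Fix\<close> available.\<close>

lemma der_height_mono:
  assumes "der H \<alpha> \<rho> \<Gamma>" "\<beta> \<in> H {}" "\<And>\<gamma>. \<gamma> < \<alpha> \<Longrightarrow> \<gamma> < \<beta>" "Omega \<le> \<beta>"
  shows "der H \<beta> \<rho> \<Gamma>"
  unfolding der_def
proof
  assume "admissible H \<Gamma>"
  then have con: "controlled H \<beta> \<Gamma>" and "derivation H \<alpha> \<rho> \<Gamma>"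
    using assms by (auto simp: controlled_iff der_def)
  from this(2) con show "derivation H \<beta> \<rho> \<Gamma>"
  proof cases
    case (Conj A \<delta> F)
    then have "\<forall>\<gamma><\<delta>. \<exists>\<alpha>'<\<beta>. derivation (relativize H {\<gamma>}) \<alpha>' \<rho> (\<Gamma> \<union> {F \<gamma>})"
      using assms(3) by blast
    then show ?thesis using derivation.Conj con Conj by blast
  next
    case (Disj A \<delta> F \<gamma> \<alpha>')
    then show ?thesis using derivation.Disj[OF con] assms(3) by blast
  next
    case (Cut A \<alpha>')
    then show ?thesis using derivation.Cut[OF con] assms(3) by blast
  next
    case (Fix \<phi> t \<alpha>')
    then show ?thesis using derivation.Fix[OF con assms(4)] assms(3) by blast
  qed
qed


section \<open>Tautologies\<close>

primrec depth :: "'p fm \<Rightarrow> nat" where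
  "depth (Eq s t) = 0"
| "depth (Neq s t) = 0"
| "depth (Pos P t) = 0"
| "depth (Neg P t) = 0"
| "depth (And A B) = Suc (max (depth A) (depth B))"
| "depth (Or A B) = Suc (max (depth A) (depth B))"
| "depth (All A) = Suc (depth A)"
| "depth (Ex A) = Suc (depth A)"

lemma inst_neg: "inst (neg A) t = neg (inst A t)"
  by (simp add: inst_def subst_neg)

definition same_values :: "(nat \<Rightarrow> tm) \<Rightarrow> (nat \<Rightarrow> tm) \<Rightarrow> bool" where
  "same_values \<sigma> \<tau> \<longleftrightarrow> (\<forall>i. tval (\<sigma> i) = tval (\<tau> i))"

lemma same_values_case_nat [intro]:
  "same_values \<sigma> \<tau> \<Longrightarrow> tval s = tval t \<Longrightarrow> same_values (case_nat s \<sigma>) (case_nat t \<tau>)"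
  by (auto simp: same_values_def split: nat.split)

lemma same_values_refl [simp, intro]: "same_values \<sigma> \<sigma>"
  by (simp add: same_values_def)

lemma same_valuesD: "same_values \<sigma> \<tau> \<Longrightarrow> tval (subst_tm \<sigma> t) = tval (subst_tm \<tau> t)"
  by (rule tval_subst_tm) (simp add: same_values_def)

lemma der_All_uniform:
  assumes "\<And>n. der H \<alpha>' \<rho> (insert (inst A (num n)) \<Gamma>)" "\<alpha>' < \<alpha>"
    and "nice H" "\<alpha> \<in> H {}" "All A \<in> \<Gamma>"
  shows "der H \<alpha> \<rho> \<Gamma>"
  by (rule der_All[OF assms(3-5)]) (use assms(1,2) in blast)

text \<open>
  Allowing different substitutions with the same values on both sides makes the equality axioms
  and the instantiation of quantifiers by closed terms into special cases.
\<close>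

lemma der_tautology:
  assumes "nice H" "\<gamma> \<in> H {}" "\<gamma> \<le> Omega" "params C \<subseteq> {\<gamma>}"
    and "closing \<sigma>" "closing \<tau>" "same_values \<sigma> \<tau>"
    and "subst \<sigma> C \<in> \<Gamma>" "neg (subst \<tau> C) \<in> \<Gamma>"
  shows "der H (omega_pow \<gamma> (2 * depth C)) \<rho> \<Gamma>"
  using wf_less_ot assms
proof (induction \<gamma> arbitrary: H C \<sigma> \<tau> \<Gamma> rule: wf_induct_rule)
  case (less \<gamma>)
  \<comment> \<open>Literals of stage \<gamma>: \<open>der_Neg\<close> branches over all \<delta>
    \<prec> \<gamma>, and \<open>der_Pos\<close> answers with the same \<delta>, which the
    relativized operator makes available. The outer hypothesis for \<delta> treats the operator form
    at stage \<delta>.\<close>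
  have stage: "der H (omega_pow \<gamma> 0) \<rho> \<Gamma>"
    if H: "nice H" "\<gamma> \<in> H {}" and st: "fv_tm s = {}" "fv_tm t = {}" "tval s = tval t"
      and \<Gamma>: "Pos (\<phi>, \<gamma>) s \<in> \<Gamma>" "Neg (\<phi>, \<gamma>) t \<in> \<Gamma>" for H s t \<phi> \<Gamma>
  proof (rule der_Neg[OF H(1) _ \<Gamma>(2)])
    fix \<delta> assume \<delta>: "\<delta> < \<gamma>"
    let ?W = "with_pred \<phi> (\<phi>, \<delta>)" and ?H = "relativize H {\<delta>}"
    let ?\<Gamma> = "insert (neg (inst ?W t)) \<Gamma>"
    have H': "nice ?H" "\<delta> \<in> ?H {}" using H nice_relativize relativize_self by auto
    have "\<delta> \<le> Omega" using less_Omega_downward[OF \<delta> less.prems(3)] by (simp add: less_eq_ot_def)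
    have "der ?H (omega_pow \<delta> (Suc (2 * depth ?W))) \<rho> ?\<Gamma>"
    proof (rule der_Pos[OF H'(1) _ _ \<delta> less_omega_pow H'(2) omega_pow_Suc_mono])
      show "der ?H (omega_pow \<delta> (2 * depth ?W)) \<rho> (insert (inst ?W s) ?\<Gamma>)"
      proof (rule less.IH)
        show "(\<delta>, \<gamma>) \<in> {(a, b). a < b}" using \<delta> by simp
        \<comment> \<open>\<open>Zero\<close> is a dummy for the indices above 0, which do not occur
          in operator forms.\<close>
        show "subst (case_nat s (\<lambda>_. Zero)) ?W \<in> insert (inst ?W s) ?\<Gamma>"
          "neg (subst (case_nat t (\<lambda>_. Zero)) ?W) \<in> insert (inst ?W s) ?\<Gamma>"
          by (simp_all flip: inst_with_pred)
      qed (use H' \<open>\<delta> \<le> Omega\<close> st params_with_pred in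
          \<open>auto simp: closing_def same_values_def split: nat.split\<close>)
    qed (use H' \<Gamma> in auto)
    then show "\<exists>\<alpha>'<omega_pow \<gamma> 0. der ?H \<alpha>' \<rho> ?\<Gamma>"
      using omega_pow_mono[OF \<delta>] by blast
  qed (use H in auto)
  show ?case using less.prems
  \<comment> \<open>Each connective costs two inferences, one for the formula and one for its
    negation, whence the factor 2.\<close>
  proof (induction C arbitrary: \<sigma> \<tau> \<Gamma>)
    case (Eq s t)
    have in_H: "omega_pow \<gamma> (2 * depth (Eq s t)) \<in> H {}" using Eq by (intro omega_pow_in_nice)
    show ?case
    proof (cases "tval (subst_tm \<sigma> s) = tval (subst_tm \<sigma> t)")
      case True
      then show ?thesis using Eq in_H by (intro der_true_Eq[of _ _ "subst_tm \<sigma> s" "subst_tm \<sigma> t"]) auto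
    next
      case False
      then have "tval (subst_tm \<tau> s) \<noteq> tval (subst_tm \<tau> t)"
        using same_valuesD[OF Eq.prems(7)] by simp
      then show ?thesis using Eq in_H by (intro der_true_Neq[of _ _ "subst_tm \<tau> s" "subst_tm \<tau> t"]) auto
    qed
  next
    case (Neq s t)
    have in_H: "omega_pow \<gamma> (2 * depth (Neq s t)) \<in> H {}" using Neq by (intro omega_pow_in_nice)
    show ?case
    proof (cases "tval (subst_tm \<sigma> s) = tval (subst_tm \<sigma> t)")
      case True
      then have "tval (subst_tm \<tau> s) = tval (subst_tm \<tau> t)"
        using same_valuesD[OF Neq.prems(7)] by simp
      then show ?thesis using Neq in_H by (intro der_true_Eq[of _ _ "subst_tm \<tau> s" "subst_tm \<tau> t"]) auto
    next
      case False
      then show ?thesis using Neq in_H by (intro der_true_Neq[of _ _ "subst_tm \<sigma> s" "subst_tm \<sigma> t"]) auto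
    qed
  next
    case (Pos P t)
    then obtain \<phi> where "P = (\<phi>, \<gamma>)" by (cases P) auto
    then show ?case using Pos.prems same_valuesD[OF Pos.prems(7), of t]
        stage[of H "subst_tm \<sigma> t" "subst_tm \<tau> t" \<phi> \<Gamma>] by simp
  next
    case (Neg P t)
    then obtain \<phi> where "P = (\<phi>, \<gamma>)" by (cases P) auto
    then show ?case using Neg.prems same_valuesD[OF Neg.prems(7), of t]
        stage[of H "subst_tm \<tau> t" "subst_tm \<sigma> t" \<phi> \<Gamma>] by simp
  next
    case (And A B)
    have neg: "Or (neg (subst \<tau> A)) (neg (subst \<tau> B)) \<in> insert C \<Gamma>" for C using And.prems by simp
    have "der H (omega_pow \<gamma> (Suc (2 * depth A))) \<rho> (insert (subst \<sigma> A) \<Gamma>)"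
      using And.prems
      by (intro der_Or1[OF _ _ neg fin_less_omega_pow omega_pow_Suc_mono And.IH(1)]) auto
    moreover have "der H (omega_pow \<gamma> (Suc (2 * depth B))) \<rho> (insert (subst \<sigma> B) \<Gamma>)"
      using And.prems
      by (intro der_Or2[OF _ _ neg fin_less_omega_pow omega_pow_Suc_mono And.IH(2)]) auto
    ultimately show ?case
      by (rule der_And[rotated 5, OF _ _ _ _ _ omega_pow_Suc_mono omega_pow_Suc_mono])
        (use And.prems in auto)
  next
    case (Or A B)
    have pos: "Or (subst \<sigma> A) (subst \<sigma> B) \<in> insert C \<Gamma>" for C using Or.prems by simp
    have "der H (omega_pow \<gamma> (Suc (2 * depth A))) \<rho> (insert (neg (subst \<tau> A)) \<Gamma>)"
      using Or.prems
      by (intro der_Or1[OF _ _ pos fin_less_omega_pow omega_pow_Suc_mono Or.IH(1)]) auto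
    moreover have "der H (omega_pow \<gamma> (Suc (2 * depth B))) \<rho> (insert (neg (subst \<tau> B)) \<Gamma>)"
      using Or.prems
      by (intro der_Or2[OF _ _ pos fin_less_omega_pow omega_pow_Suc_mono Or.IH(2)]) auto
    ultimately show ?case
      by (rule der_And[rotated 5, OF _ _ _ _ _ omega_pow_Suc_mono omega_pow_Suc_mono])
        (use Or.prems in auto)
  next
    case (All A)
    have neg: "Ex (neg (subst (up \<tau>) A)) \<in> insert C \<Gamma>" for C using All.prems by simp
    have "der H (omega_pow \<gamma> (Suc (2 * depth A))) \<rho> (insert (inst (subst (up \<sigma>) A) (num n)) \<Gamma>)" for n
    proof (rule der_Ex[OF _ _ neg fin_less_omega_pow omega_pow_Suc_mono All.IH])
      show "subst (case_nat (num n) \<sigma>) A \<in> insert (inst (neg (subst (up \<tau>) A)) (num n))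
          (insert (inst (subst (up \<sigma>) A) (num n)) \<Gamma>)"
        "neg (subst (case_nat (num n) \<tau>) A) \<in> insert (inst (neg (subst (up \<tau>) A)) (num n))
          (insert (inst (subst (up \<sigma>) A) (num n)) \<Gamma>)"
        by (simp_all add: inst_neg inst_subst_up)
    qed (use All.prems in auto)
    moreover have "omega_pow \<gamma> (Suc (2 * depth A)) < omega_pow \<gamma> (2 * depth (All A))"
      by (rule omega_pow_Suc_mono) simp
    ultimately show ?case
      by (rule der_All_uniform[where A = "subst (up \<sigma>) A"]) (use All.prems in auto)
  next
    case (Ex A)
    have pos: "Ex (subst (up \<sigma>) A) \<in> insert C \<Gamma>" for C using Ex.prems by simp
    have "der H (omega_pow \<gamma> (Suc (2 * depth A))) \<rho> (insert (inst (neg (subst (up \<tau>) A)) (num n)) \<Gamma>)" for n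
    proof (rule der_Ex[OF _ _ pos fin_less_omega_pow omega_pow_Suc_mono Ex.IH])
      show "subst (case_nat (num n) \<sigma>) A \<in> insert (inst (subst (up \<sigma>) A) (num n))
          (insert (inst (neg (subst (up \<tau>) A)) (num n)) \<Gamma>)"
        "neg (subst (case_nat (num n) \<tau>) A) \<in> insert (inst (subst (up \<sigma>) A) (num n))
          (insert (inst (neg (subst (up \<tau>) A)) (num n)) \<Gamma>)"
        by (simp_all add: inst_neg inst_subst_up)
    qed (use Ex.prems in auto)
    moreover have "omega_pow \<gamma> (Suc (2 * depth A)) < omega_pow \<gamma> (2 * depth (Ex A))"
      by (rule omega_pow_Suc_mono) simp
    ultimately show ?case
      by (rule der_All_uniform[where A = "neg (subst (up \<tau>) A)"]) (use Ex.prems in auto)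
  qed
qed


section \<open>Induction and inductive definitions\<close>

text \<open>The \<open>Ex\<close> formula negates the induction step and is instantiated with the
  predecessor of the number. Its first conjunct is handled by recursion, while the second, the
  negation of \<psi>(n+1), closes against \<psi>(n+1) in the sequent. Each step costs two
  inferences.\<close>

lemma der_number_induction:
  assumes "nice H" "closing \<sigma>" "params \<psi> \<subseteq> {Omega}"
    and "neg (subst (case_nat Zero \<sigma>) \<psi>) \<in> \<Gamma>"
    and "Ex (And (subst (up \<sigma>) \<psi>) (neg (subst (up \<sigma>) (repl \<psi> (Succ (Var 0)))))) \<in> \<Gamma>"
    and "subst (case_nat (num n) \<sigma>) \<psi> \<in> \<Gamma>"
  shows "der H (omega_pow Omega (2 * depth \<psi> + 2 * n)) \<rho> \<Gamma>"
  using assms(4-)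
proof (induction n arbitrary: \<Gamma>)
  case 0
  have "der H (omega_pow Omega (2 * depth \<psi>)) \<rho> \<Gamma>"
    by (rule der_tautology[where \<sigma> = "case_nat Zero \<sigma>" and \<tau> = "case_nat Zero \<sigma>"])
      (use assms(1-3) 0[unfolded num.simps] in auto)
  then show ?case by simp
next
  case (Suc n)
  let ?k = "2 * depth \<psi> + 2 * n"
  let ?A = "subst (case_nat (num n) \<sigma>) \<psi>" and ?B = "subst (case_nat (Succ (num n)) \<sigma>) \<psi>"
  have inst: "inst (And (subst (up \<sigma>) \<psi>) (neg (subst (up \<sigma>) (repl \<psi> (Succ (Var 0)))))) (num n) =
      And ?A (neg ?B)"
    using inst_subst_up[of \<sigma> "And \<psi> (neg (repl \<psi> (Succ (Var 0))))" "num n"]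
    by (simp add: subst_neg subst_repl)
  have "der H (omega_pow Omega (Suc ?k)) \<rho> (insert (And ?A (neg ?B)) \<Gamma>)"
  proof (rule der_And[OF assms(1), where A = ?A and B = "neg ?B"])
    show "der H (omega_pow Omega ?k) \<rho> (insert ?A (insert (And ?A (neg ?B)) \<Gamma>))"
      using Suc by auto
    show "der H (omega_pow Omega (2 * depth \<psi>)) \<rho> (insert (neg ?B) (insert (And ?A (neg ?B)) \<Gamma>))"
      by (rule der_tautology[where \<sigma> = "case_nat (Succ (num n)) \<sigma>" and \<tau> = "case_nat (Succ (num n)) \<sigma>"])
        (use assms(1-3) Suc.prems[unfolded num.simps] in auto)
  qed (use assms(1) in \<open>auto intro: omega_pow_Suc_mono\<close>)
  then show ?case
    by (intro der_Ex[OF assms(1) _ Suc.prems(2) fin_less_omega_pow[of n], where \<alpha>' = "omega_pow Omega (Suc ?k)"])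
      (use assms(1) inst in \<open>auto intro: omega_pow_Suc_mono\<close>)
qed

text \<open>Passing a quantifier lifts the parameters of \<open>B\<close> by one and adds the term
  \<open>u\<close> for the bound variable to the substitution; the two shifts cancel.\<close>

lemma subst_up_lift:
  "subst (case_nat t (\<lambda>i. case_nat u \<tau> (Suc i))) (subst (up (\<lambda>i. Var (Suc i))) B) =
    subst (case_nat t (\<lambda>i. \<tau> (Suc i))) B"
  unfolding subst_subst
proof (rule subst_cong)
  fix i show "subst_tm (case_nat t (\<lambda>i. case_nat u \<tau> (Suc i))) (up (\<lambda>i. Var (Suc i)) i) =
      case_nat t (\<lambda>i. \<tau> (Suc i)) i"
    by (cases i) auto
qed

text \<open>Monotonicity of positive forms, by induction on \<open>C\<close>: the leaves
  \<open>X t\<close> are supplied by \<open>stage\<close>, which may use the side formula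
  \<open>D\<close>, and positivity excludes \<open>Neg\<close>. The hypothesis on \<open>B\<close>
  says that its instances under \<tau>' are those of \<psi> under \<sigma>; this invariant survives
  the lifting of \<open>B\<close> below quantifiers.\<close>

lemma der_positive_mono:
  assumes C: "positive C"
    and stage: "\<And>\<Gamma> s t. \<lbrakk>fv_tm s = {}; fv_tm t = {}; tval s = tval t; D \<in> \<Gamma>;
      Neg (\<phi>, \<delta>) s \<in> \<Gamma>; subst (case_nat t \<sigma>) \<psi> \<in> \<Gamma>\<rbrakk> \<Longrightarrow> der H (height \<delta> 0) \<rho> \<Gamma>"
    and H: "nice H" "\<delta> \<in> H {}" "\<delta> \<le> Omega"
    and "closing \<tau>" "closing \<tau>'" "same_values \<tau> \<tau>'" "D \<in> \<Gamma>"
    and "\<And>t. subst (case_nat t (\<lambda>i. \<tau>' (Suc i))) B = subst (case_nat t \<sigma>) \<psi>"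
    and "neg (subst \<tau> (map_preds (\<lambda>_. (\<phi>, \<delta>)) C)) \<in> \<Gamma>" "subst \<tau>' (with_fm C B) \<in> \<Gamma>"
  shows "der H (height \<delta> (2 * depth C)) \<rho> \<Gamma>"
  using C assms(6-)
proof (induction C arbitrary: \<tau> \<tau>' B \<Gamma>)
  case (Eq s t)
  have in_H: "height \<delta> (2 * depth (Eq s t)) \<in> H {}" using H by (intro height_in_nice)
  show ?case
  proof (cases "tval (subst_tm \<tau>' s) = tval (subst_tm \<tau>' t)")
    case True
    then show ?thesis using Eq H in_H by (intro der_true_Eq[of _ _ "subst_tm \<tau>' s" "subst_tm \<tau>' t"]) auto
  next
    case False
    then have "tval (subst_tm \<tau> s) \<noteq> tval (subst_tm \<tau> t)"
      using same_valuesD[OF Eq.prems(4)] by simp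
    then show ?thesis using Eq H in_H by (intro der_true_Neq[of _ _ "subst_tm \<tau> s" "subst_tm \<tau> t"]) auto
  qed
next
  case (Neq s t)
  have in_H: "height \<delta> (2 * depth (Neq s t)) \<in> H {}" using H by (intro height_in_nice)
  show ?case
  proof (cases "tval (subst_tm \<tau>' s) = tval (subst_tm \<tau>' t)")
    case True
    then have "tval (subst_tm \<tau> s) = tval (subst_tm \<tau> t)"
      using same_valuesD[OF Neq.prems(4)] by simp
    then show ?thesis using Neq H in_H by (intro der_true_Eq[of _ _ "subst_tm \<tau> s" "subst_tm \<tau> t"]) auto
  next
    case False
    then show ?thesis using Neq H in_H by (intro der_true_Neq[of _ _ "subst_tm \<tau>' s" "subst_tm \<tau>' t"]) auto
  qed
next
  case (Pos P t)
  have "subst (case_nat (subst_tm \<tau>' t) \<sigma>) \<psi> \<in> \<Gamma>"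
    using Pos.prems(6)[of "subst_tm \<tau>' t"] Pos.prems(8) by (simp add: subst_repl)
  then have "der H (height \<delta> 0) \<rho> \<Gamma>"
    using Pos.prems same_valuesD[OF Pos.prems(4)]
    by (intro stage[of "subst_tm \<tau> t" "subst_tm \<tau>' t"]) auto
  then show ?case by simp
next
  case (Neg P t)
  then show ?case by simp
next
  case (And C1 C2)
  let ?N = "\<lambda>C. neg (subst \<tau> (map_preds (\<lambda>_. (\<phi>, \<delta>)) C))" and ?P = "\<lambda>C. subst \<tau>' (with_fm C B)"
  have neg: "Or (?N C1) (?N C2) \<in> insert X \<Gamma>" for X using And.prems by simp
  have "der H (height \<delta> (Suc (2 * depth C1))) \<rho> (insert (?P C1) \<Gamma>)"
    using And.prems H
    by (intro der_Or1[OF _ _ neg fin_less_height height_Suc_mono And.IH(1)]) auto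
  moreover have "der H (height \<delta> (Suc (2 * depth C2))) \<rho> (insert (?P C2) \<Gamma>)"
    using And.prems H
    by (intro der_Or2[OF _ _ neg fin_less_height height_Suc_mono And.IH(2)]) auto
  ultimately show ?case
    by (rule der_And[rotated 5, OF _ _ _ _ _ height_Suc_mono height_Suc_mono])
      (use And.prems H in auto)
next
  case (Or C1 C2)
  let ?N = "\<lambda>C. neg (subst \<tau> (map_preds (\<lambda>_. (\<phi>, \<delta>)) C))" and ?P = "\<lambda>C. subst \<tau>' (with_fm C B)"
  have pos: "Or (?P C1) (?P C2) \<in> insert X \<Gamma>" for X using Or.prems by simp
  have "der H (height \<delta> (Suc (2 * depth C1))) \<rho> (insert (?N C1) \<Gamma>)"
    using Or.prems H
    by (intro der_Or1[OF _ _ pos fin_less_height height_Suc_mono Or.IH(1)]) auto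
  moreover have "der H (height \<delta> (Suc (2 * depth C2))) \<rho> (insert (?N C2) \<Gamma>)"
    using Or.prems H
    by (intro der_Or2[OF _ _ pos fin_less_height height_Suc_mono Or.IH(2)]) auto
  ultimately show ?case
    by (rule der_And[rotated 5, OF _ _ _ _ _ height_Suc_mono height_Suc_mono])
      (use Or.prems H in auto)
next
  case (All C)
  let ?B = "subst (up (\<lambda>i. Var (Suc i))) B"
  let ?N = "subst (up \<tau>) (map_preds (\<lambda>_. (\<phi>, \<delta>)) C)" and ?P = "subst (up \<tau>') (with_fm C ?B)"
  have B: "subst (case_nat t (\<lambda>i. case_nat (num n) \<tau>' (Suc i))) ?B = subst (case_nat t \<sigma>) \<psi>" for n t
    unfolding subst_up_lift using All.prems(6) .
  have neg: "Ex (neg ?N) \<in> insert X \<Gamma>" for X using All.prems by simp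
  have "der H (height \<delta> (Suc (2 * depth C))) \<rho> (insert (inst ?P (num n)) \<Gamma>)" for n
  proof (rule der_Ex[OF H(1) _ neg fin_less_height height_Suc_mono All.IH])
    show "neg (subst (case_nat (num n) \<tau>) (map_preds (\<lambda>_. (\<phi>, \<delta>)) C))
        \<in> insert (inst (neg ?N) (num n)) (insert (inst ?P (num n)) \<Gamma>)"
      "subst (case_nat (num n) \<tau>') (with_fm C ?B)
        \<in> insert (inst (neg ?N) (num n)) (insert (inst ?P (num n)) \<Gamma>)"
      by (simp_all add: inst_neg inst_subst_up)
    show "subst (case_nat t (\<lambda>i. case_nat (num n) \<tau>' (Suc i))) ?B = subst (case_nat t \<sigma>) \<psi>" for t
      by (rule B)
  qed (use All.prems H in auto)
  moreover have "height \<delta> (Suc (2 * depth C)) < height \<delta> (2 * depth (All C))"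
    using H by (intro height_Suc_mono) auto
  ultimately show ?case
    by (rule der_All_uniform[where A = ?P]) (use All.prems H in auto)
next
  case (Ex C)
  let ?B = "subst (up (\<lambda>i. Var (Suc i))) B"
  let ?N = "subst (up \<tau>) (map_preds (\<lambda>_. (\<phi>, \<delta>)) C)" and ?P = "subst (up \<tau>') (with_fm C ?B)"
  have B: "subst (case_nat t (\<lambda>i. case_nat (num n) \<tau>' (Suc i))) ?B = subst (case_nat t \<sigma>) \<psi>" for n t
    unfolding subst_up_lift using Ex.prems(6) .
  have pos: "Ex ?P \<in> insert X \<Gamma>" for X using Ex.prems by simp
  have "der H (height \<delta> (Suc (2 * depth C))) \<rho> (insert (inst (neg ?N) (num n)) \<Gamma>)" for n
  proof (rule der_Ex[OF H(1) _ pos fin_less_height height_Suc_mono Ex.IH])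
    show "neg (subst (case_nat (num n) \<tau>) (map_preds (\<lambda>_. (\<phi>, \<delta>)) C))
        \<in> insert (inst ?P (num n)) (insert (inst (neg ?N) (num n)) \<Gamma>)"
      "subst (case_nat (num n) \<tau>') (with_fm C ?B)
        \<in> insert (inst ?P (num n)) (insert (inst (neg ?N) (num n)) \<Gamma>)"
      by (simp_all add: inst_neg inst_subst_up)
    show "subst (case_nat t (\<lambda>i. case_nat (num n) \<tau>' (Suc i))) ?B = subst (case_nat t \<sigma>) \<psi>" for t
      by (rule B)
  qed (use Ex.prems H in auto)
  moreover have "height \<delta> (Suc (2 * depth C)) < height \<delta> (2 * depth (Ex C))"
    using H by (intro height_Suc_mono) auto
  ultimately show ?case
    by (rule der_All_uniform[where A = "neg ?N"]) (use Ex.prems H in auto)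
qed

text \<open>\<open>D\<close> negates the closure hypothesis for \<psi>. For each \<delta> \<prec>
  \<gamma> produced by \<open>der_Neg\<close>, it is instantiated with the value n of
  \<open>t\<close>. Monotonicity, fed by the induction hypothesis at \<delta>, leads from stage
  \<delta> to \<phi>(n, \<psi>); the other conjunct \<not>\<psi>(n) closes against
  \<psi>(t).\<close>

lemma der_stage_induction:
  fixes \<phi> :: opform and \<psi> :: inf_fm and \<sigma> :: "nat \<Rightarrow> tm"
  defines "D \<equiv> Ex (And (subst (up \<sigma>) (with_fm (form_of \<phi>) \<psi>)) (neg (subst (up \<sigma>) \<psi>)))"
  assumes \<psi>: "closing \<sigma>" "params \<psi> \<subseteq> {Omega}"
    and "nice H" "\<gamma> \<in> H {}" "\<gamma> \<le> Omega"
    and "fv_tm s = {}" "fv_tm t = {}" "tval s = tval t"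
    and "D \<in> \<Gamma>" "Neg (\<phi>, \<gamma>) s \<in> \<Gamma>" "subst (case_nat t \<sigma>) \<psi> \<in> \<Gamma>"
  shows "der H (height \<gamma> 0) \<rho> \<Gamma>"
  using wf_less_ot assms(4-)
proof (induction \<gamma> arbitrary: H s t \<Gamma> rule: wf_induct_rule)
  case (less \<gamma>)
  show ?case
  proof (rule der_Neg[OF less.prems(1) _ less.prems(8)])
    fix \<delta> assume \<delta>: "\<delta> < \<gamma>"
    let ?H = "relativize H {\<delta>}" and ?n = "tval t" and ?k = "2 * depth (form_of \<phi>)"
    let ?\<Gamma> = "insert (neg (inst (with_pred \<phi> (\<phi>, \<delta>)) s)) \<Gamma>"
    let ?A = "subst (case_nat (num ?n) \<sigma>) (with_fm (form_of \<phi>) \<psi>)"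
    let ?B = "neg (subst (case_nat (num ?n) \<sigma>) \<psi>)"
    have H: "nice ?H" "\<delta> \<in> ?H {}" using less.prems nice_relativize relativize_self by auto
    have \<delta>': "\<delta> \<le> Omega" using less_Omega_downward[OF \<delta> less.prems(3)] by (simp add: less_eq_ot_def)
    have inst: "inst (And (subst (up \<sigma>) (with_fm (form_of \<phi>) \<psi>)) (neg (subst (up \<sigma>) \<psi>))) (num ?n) =
        And ?A ?B"
      using inst_subst_up[of \<sigma> "And (with_fm (form_of \<phi>) \<psi>) (neg \<psi>)" "num ?n"]
      by (simp add: subst_neg)
    have "der ?H (height \<delta> (Suc ?k)) \<rho> (insert (And ?A ?B) ?\<Gamma>)"
    proof (rule der_And[OF H(1), where A = ?A and B = ?B])
      show "der ?H (height \<delta> ?k) \<rho> (insert ?A (insert (And ?A ?B) ?\<Gamma>))"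
      proof (rule der_positive_mono[where D = D and \<phi> = \<phi> and \<sigma> = \<sigma> and \<psi> = \<psi> and
            \<tau> = "case_nat s \<sigma>" and \<tau>' = "case_nat (num ?n) \<sigma>" and B = \<psi>])
        show "neg (subst (case_nat s \<sigma>) (map_preds (\<lambda>_. (\<phi>, \<delta>)) (form_of \<phi>)))
            \<in> insert ?A (insert (And ?A ?B) ?\<Gamma>)"
          using inst_with_pred[of \<phi> "(\<phi>, \<delta>)" s \<sigma>] by (simp add: with_pred_def)
        show "der ?H (height \<delta> 0) \<rho> \<Gamma>'" if "fv_tm s' = {}" "fv_tm t' = {}" "tval s' = tval t'" "D \<in> \<Gamma>'"
          "Neg (\<phi>, \<delta>) s' \<in> \<Gamma>'" "subst (case_nat t' \<sigma>) \<psi> \<in> \<Gamma>'" for \<Gamma>' s' t'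
          using that \<delta> \<delta>' H by (intro less.IH[of \<delta> ?H s' t']) auto
      qed (use H \<delta>' \<psi> less.prems positive_form_of in auto)
      \<comment> \<open>This tautology has height \<Omega> + k + 1, as \<psi> may mention stage
        \<Omega>; the initial summand \<Omega> of \<open>height\<close> leaves room for it.\<close>
      show "der ?H (omega_pow Omega (2 * depth \<psi>)) \<rho> (insert ?B (insert (And ?A ?B) ?\<Gamma>))"
        by (rule der_tautology[where \<sigma> = "case_nat t \<sigma>" and \<tau> = "case_nat (num ?n) \<sigma>"])
          (use H \<psi> less.prems in auto)
    qed (use H \<delta>' in \<open>auto intro: height_Suc_mono omega_pow_less_height\<close>)
    then have "der ?H (height \<delta> (Suc (Suc ?k))) \<rho> ?\<Gamma>"
      by - (rule der_Ex[OF H(1) _ _ fin_less_height[of \<delta> ?n], where \<alpha>' = "height \<delta> (Suc ?k)"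
            and A = "And (subst (up \<sigma>) (with_fm (form_of \<phi>) \<psi>)) (neg (subst (up \<sigma>) \<psi>))"],
        use H \<delta>' less.prems(7) inst in \<open>auto simp: D_def intro: height_Suc_mono\<close>)
    then show "\<exists>\<alpha>'<height \<gamma> 0. der ?H \<alpha>' \<rho> ?\<Gamma>"
      using height_mono[OF \<delta> \<delta>' less.prems(3)] by blast
  qed (use less.prems in auto)
qed


section \<open>The embedding\<close>

lemma der_height_Omega_mono:
  assumes "nice H" "der H (height Omega k) \<rho> \<Gamma>" "k \<le> n"
  shows "der H (height Omega n) \<rho> \<Gamma>"
  using assms Omega_less_height less_height_Omega_mono
  by (intro der_height_mono[OF assms(2)]) (auto simp: less_eq_ot_def)

lemma der_omega_pow_Omega:
  assumes "nice H" "der H (omega_pow Omega k) \<rho> \<Gamma>"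
  shows "der H (height Omega n) \<rho> \<Gamma>"
  using assms Omega_less_height less_omega_pow_Omega
  by (intro der_height_mono[OF assms(2)]) (auto simp: less_eq_ot_def)

lemma der_Or:
  assumes "nice H" "Or A B \<in> \<Gamma>" "der H (height Omega n) \<rho> (insert B (insert A \<Gamma>))"
  shows "der H (height Omega (Suc (Suc n))) \<rho> \<Gamma>"
proof (rule der_Or1[OF assms(1) _ assms(2)])
  show "der H (height Omega (Suc n)) \<rho> (insert A \<Gamma>)"
    using assms
    by (intro der_Or2[OF assms(1) _ _ fin_less_height height_Suc_mono assms(3)]) auto
qed (use assms(1) in \<open>auto intro: fin_less_height height_Suc_mono\<close>)

text \<open>If the values differ, \<open>Neq s t\<close> is a true literal and closes the sequent,
  so equal values may be assumed.\<close>

lemma der_Imp_Eq: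
  assumes "nice H" "Or (Neq s t) A \<in> \<Gamma>"
    and "tval s = tval t \<Longrightarrow> der H (height Omega n) \<rho> (insert A (insert (Neq s t) \<Gamma>))"
  shows "der H (height Omega (Suc (Suc n))) \<rho> \<Gamma>"
proof (rule der_Or[OF assms(1,2)])
  show "der H (height Omega n) \<rho> (insert A (insert (Neq s t) \<Gamma>))"
  proof (cases "tval s = tval t")
    case False
    then show ?thesis using assms(1) by (intro der_true_Neq) auto
  qed (use assms(3) in simp)
qed

abbreviation close_fm :: "(nat \<Rightarrow> tm) \<Rightarrow> opform fm \<Rightarrow> inf_fm" where
  "close_fm \<sigma> A \<equiv> subst \<sigma> (plus_fm A)"

lemma der_Induction:
  assumes "nice H" "closing \<sigma>"
    and "close_fm \<sigma> (Imp (And (inst A Zero) (All (Imp A (repl A (Succ v0))))) (All A)) \<in> \<Gamma>"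
  shows "der H (height Omega 5) \<rho> \<Gamma>"
proof -
  let ?A = "plus_fm A"
  let ?Z = "neg (subst (case_nat Zero \<sigma>) ?A)"
  let ?S = "Ex (And (subst (up \<sigma>) ?A) (neg (subst (up \<sigma>) (repl ?A (Succ (Var 0))))))"
  let ?\<Gamma> = "insert ?S (insert ?Z (insert (All (subst (up \<sigma>) ?A)) (insert (Or ?Z ?S) \<Gamma>)))"
  have "Or (Or ?Z ?S) (All (subst (up \<sigma>) ?A)) \<in> \<Gamma>"
    using assms(3) by (simp add: plus_fm_neg plus_fm_inst plus_fm_repl subst_neg subst_inst)
  \<comment> \<open>The heights \<Omega> + 2d + 2n + 1 of the premises grow with n, but all lie
    below \<Omega>*2.\<close>
  moreover have "der H (height Omega 1) \<rho> ?\<Gamma>"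
  proof (rule der_All[OF assms(1), of _ "subst (up \<sigma>) ?A"])
    fix n
    have "der H (omega_pow Omega (2 * depth ?A + 2 * n)) \<rho> (insert (inst (subst (up \<sigma>) ?A) (num n)) ?\<Gamma>)"
      using assms by (intro der_number_induction[where \<sigma> = \<sigma>]) (auto simp: inst_subst_up params_plus_fm)
    then show "\<exists>\<alpha>'<height Omega 1. der H \<alpha>' \<rho> (insert (inst (subst (up \<sigma>) ?A) (num n)) ?\<Gamma>)"
      using omega_pow_less_height[of Omega] by auto
  qed (use assms(1) in auto)
  then have "der H (height Omega 3) \<rho> (insert (All (subst (up \<sigma>) ?A)) (insert (Or ?Z ?S) \<Gamma>))"
    using der_Or[OF assms(1), of ?Z ?S _ 1] by (simp add: numeral_eq_Suc)
  ultimately show ?thesis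
    using der_Or[OF assms(1), of "Or ?Z ?S" "All (subst (up \<sigma>) ?A)" _ 3] by (simp add: numeral_eq_Suc)
qed

lemma der_F:
  assumes "nice H" "closing \<sigma>"
    and "close_fm \<sigma> (All (Imp (with_pred \<phi> \<phi>) (Pos \<phi> v0))) \<in> \<Gamma>"
  shows "der H (height Omega 3) \<rho> \<Gamma>"
proof -
  let ?W = "with_pred \<phi> (\<phi>, Omega)"
  let ?A = "Or (neg (subst (up \<sigma>) ?W)) (Pos (\<phi>, Omega) (Var 0))"
  have \<Gamma>: "All ?A \<in> \<Gamma>" using assms(3) by (simp add: plus_fm_neg plus_fm_with_pred subst_neg)
  show ?thesis
  proof (rule der_All[OF assms(1) _ \<Gamma>])
    fix n
    let ?N = "neg (subst (case_nat (num n) \<sigma>) ?W)" and ?P = "Pos (\<phi>, Omega) (num n)"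
    have A: "inst ?A (num n) = Or ?N ?P"
      using inst_subst_up[of \<sigma> "Or (neg ?W) (Pos (\<phi>, Omega) (Var 0))" "num n"]
      by (simp add: subst_neg)
    \<comment> \<open>Once \<open>Fix\<close> adds the unfolding of \<open>?P\<close>, the sequent
      contains \<phi>(n, I) and its negation; the tautology has height \<Omega> + k + 1.\<close>
    have "der H (height Omega 0) \<rho> (insert ?P (insert ?N (insert (Or ?N ?P) \<Gamma>)))"
    proof (rule der_Fix[OF assms(1)])
      show "der H (omega_pow Omega (2 * depth ?W)) \<rho>
          (insert (inst ?W (num n)) (insert ?P (insert ?N (insert (Or ?N ?P) \<Gamma>))))"
        using assms params_with_pred
        by (intro der_tautology[where \<sigma> = "case_nat (num n) \<sigma>" and \<tau> = "case_nat (num n) \<sigma>"])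
          (auto simp flip: inst_with_pred)
    qed (use assms(1) Omega_less_height omega_pow_less_height in \<open>auto simp: less_eq_ot_def\<close>)
    then have "der H (height Omega 2) \<rho> (insert (Or ?N ?P) \<Gamma>)"
      using der_Or[OF assms(1), of ?N ?P _ 0] by (simp add: numeral_eq_Suc)
    then show "\<exists>\<alpha>'<height Omega 3. der H \<alpha>' \<rho> (insert (inst ?A (num n)) \<Gamma>)"
      unfolding A using height_Suc_mono[of Omega 2 3] by auto
  qed (use assms(1) in auto)
qed

lemma der_L:
  assumes "nice H" "closing \<sigma>"
    and "close_fm \<sigma> (Imp (All (Imp (with_fm (form_of \<phi>) A) A)) (All (Imp (Pos \<phi> v0) A))) \<in> \<Gamma>"
  shows "der H (height Omega 5) \<rho> \<Gamma>"
proof -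
  let ?A = "plus_fm A"
  let ?D = "Ex (And (subst (up \<sigma>) (with_fm (form_of \<phi>) ?A)) (neg (subst (up \<sigma>) ?A)))"
  let ?I = "Or (Neg (\<phi>, Omega) (Var 0)) (subst (up \<sigma>) ?A)"
  have \<Gamma>: "Or ?D (All ?I) \<in> \<Gamma>"
    using assms(3) by (simp add: plus_fm_neg plus_fm_with_fm subst_neg)
  have "der H (height Omega 3) \<rho> (insert (All ?I) (insert ?D \<Gamma>))"
  proof (rule der_All[OF assms(1), of _ ?I])
    fix n
    let ?N = "Neg (\<phi>, Omega) (num n)" and ?P = "subst (case_nat (num n) \<sigma>) ?A"
    let ?\<Gamma> = "insert (Or ?N ?P) (insert (All ?I) (insert ?D \<Gamma>))"
    have I: "inst ?I (num n) = Or ?N ?P"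
      using inst_subst_up[of \<sigma> "Or (Neg (\<phi>, Omega) (Var 0)) ?A" "num n"] by simp
    \<comment> \<open>Stage induction at \<gamma> = \<Omega>, the stage of the translated predicate;
      \<open>height Omega 0\<close> is \<Omega>*2 + 1.\<close>
    have "der H (height Omega 0) \<rho> (insert ?P (insert ?N ?\<Gamma>))"
      using assms params_plus_fm
      by (intro der_stage_induction[where \<sigma> = \<sigma> and \<phi> = \<phi> and \<psi> = ?A and s = "num n" and t = "num n"])
        auto
    then have "der H (height Omega 2) \<rho> ?\<Gamma>"
      using der_Or[OF assms(1), of ?N ?P _ 0] by (simp add: numeral_eq_Suc)
    then show "\<exists>\<alpha>'<height Omega 3. der H \<alpha>' \<rho> (insert (inst ?I (num n)) (insert (All ?I) (insert ?D \<Gamma>)))"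
      unfolding I using height_Suc_mono[of Omega 2 3] by auto
  qed (use assms(1) in auto)
  then show ?thesis
    using der_Or[OF assms(1) \<Gamma>, of 3] by (simp add: numeral_eq_Suc)
qed

text \<open>Under a closing substitution the arithmetical literals are decided by values, so these
  axioms only require truth. The common bound 5 is the one of \<open>der_Induction\<close> and
  \<open>der_L\<close>.\<close>

lemma der_ID1:
  assumes "A \<in> ID1" "nice H" "closing \<sigma>" "close_fm \<sigma> A \<in> \<Gamma>"
  shows "der H (height Omega 5) \<rho> \<Gamma>"
proof -
  have in_H: "height Omega n \<in> H {}" for n using assms(2) by simp
  have "\<exists>n\<le>5. der H (height Omega n) \<rho> \<Gamma>"
    using assms(1,4)
  proof cases
    case eq_refl
    then show ?thesis using assms by (intro exI[of _ 0]) (auto intro: der_true_Eq)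
  next
    case eq_sym
    then have "Or (Neq (\<sigma> 0) (\<sigma> 1)) (Eq (\<sigma> 1) (\<sigma> 0)) \<in> \<Gamma>" using assms(4) by simp
    then have "der H (height Omega (Suc (Suc 0))) \<rho> \<Gamma>"
      by (rule der_Imp_Eq[OF assms(2)]) (rule der_true_Eq[OF assms(2) in_H insertI1], simp)
    then show ?thesis by (intro exI[of _ 2]) (auto simp: numeral_eq_Suc)
  next
    case eq_trans
    then have "Or (Neq (\<sigma> 0) (\<sigma> 1)) (Or (Neq (\<sigma> 1) (\<sigma> 2)) (Eq (\<sigma> 0) (\<sigma> 2))) \<in> \<Gamma>"
      using assms(4) by simp
    then have "der H (height Omega (Suc (Suc (Suc (Suc 0))))) \<rho> \<Gamma>"
      by (rule der_Imp_Eq[OF assms(2)])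
        (rule der_Imp_Eq[OF assms(2) insertI1], rule der_true_Eq[OF assms(2) in_H insertI1], simp)
    then show ?thesis by (intro exI[of _ 4]) (auto simp: numeral_eq_Suc)
  next
    case eq_Succ
    then have "Or (Neq (\<sigma> 0) (\<sigma> 1)) (Eq (Succ (\<sigma> 0)) (Succ (\<sigma> 1))) \<in> \<Gamma>" using assms(4) by simp
    then have "der H (height Omega (Suc (Suc 0))) \<rho> \<Gamma>"
      by (rule der_Imp_Eq[OF assms(2)]) (rule der_true_Eq[OF assms(2) in_H insertI1], simp)
    then show ?thesis by (intro exI[of _ 2]) (auto simp: numeral_eq_Suc)
  next
    case eq_Add
    then have "Or (Neq (\<sigma> 0) (\<sigma> 1)) (Or (Neq (\<sigma> 2) (\<sigma> 3))
        (Eq (Add (\<sigma> 0) (\<sigma> 2)) (Add (\<sigma> 1) (\<sigma> 3)))) \<in> \<Gamma>"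
      using assms(4) by simp
    then have "der H (height Omega (Suc (Suc (Suc (Suc 0))))) \<rho> \<Gamma>"
      by (rule der_Imp_Eq[OF assms(2)])
        (rule der_Imp_Eq[OF assms(2) insertI1], rule der_true_Eq[OF assms(2) in_H insertI1], simp)
    then show ?thesis by (intro exI[of _ 4]) (auto simp: numeral_eq_Suc)
  next
    case eq_Mul
    then have "Or (Neq (\<sigma> 0) (\<sigma> 1)) (Or (Neq (\<sigma> 2) (\<sigma> 3))
        (Eq (Mul (\<sigma> 0) (\<sigma> 2)) (Mul (\<sigma> 1) (\<sigma> 3)))) \<in> \<Gamma>"
      using assms(4) by simp
    then have "der H (height Omega (Suc (Suc (Suc (Suc 0))))) \<rho> \<Gamma>"
      by (rule der_Imp_Eq[OF assms(2)])
        (rule der_Imp_Eq[OF assms(2) insertI1], rule der_true_Eq[OF assms(2) in_H insertI1], simp)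
    then show ?thesis by (intro exI[of _ 4]) (auto simp: numeral_eq_Suc)
  next
    case (eq_I \<phi>)
    let ?N = "Neg (\<phi>, Omega) (\<sigma> 0)" and ?P = "Pos (\<phi>, Omega) (\<sigma> 1)"
    have "Or (Neq (\<sigma> 0) (\<sigma> 1)) (Or ?N ?P) \<in> \<Gamma>" using eq_I assms(4) by simp
    then have "der H (height Omega (Suc (Suc (Suc (Suc 0))))) \<rho> \<Gamma>"
    proof (rule der_Imp_Eq[OF assms(2)])
      let ?\<Gamma> = "insert (Or ?N ?P) (insert (Neq (\<sigma> 0) (\<sigma> 1)) \<Gamma>)"
      assume eq: "tval (\<sigma> 0) = tval (\<sigma> 1)"
      \<comment> \<open>Both literals are instances of \<open>Pos (\<phi>, Omega) (Var 0)\<close>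
        under substitutions with equal values, which makes this a tautology.\<close>
      have "der H (omega_pow Omega (2 * depth (Pos (\<phi>, Omega) (Var 0)))) \<rho> (insert ?P (insert ?N ?\<Gamma>))"
        using assms eq
        by (intro der_tautology[where \<sigma> = "case_nat (\<sigma> 1) \<sigma>" and \<tau> = "case_nat (\<sigma> 0) \<sigma>"])
          (auto simp: closing_def same_values_def split: nat.split)
      then have "der H (height Omega 0) \<rho> (insert ?P (insert ?N ?\<Gamma>))"
        using der_omega_pow_Omega assms(2) by blast
      then show "der H (height Omega (Suc (Suc 0))) \<rho> ?\<Gamma>" by (rule der_Or[OF assms(2) insertI1])
    qed
    then show ?thesis by (intro exI[of _ 4]) (auto simp: numeral_eq_Suc)
  next
    case Succ_nonzero
    then show ?thesis using assms
      by (intro exI[of _ 0]) (auto intro: der_true_Neq[of _ _ "Succ (\<sigma> 0)" Zero])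
  next
    case Succ_inj
    then have "Or (Neq (Succ (\<sigma> 0)) (Succ (\<sigma> 1))) (Eq (\<sigma> 0) (\<sigma> 1)) \<in> \<Gamma>" using assms(4) by simp
    then have "der H (height Omega (Suc (Suc 0))) \<rho> \<Gamma>"
      by (rule der_Imp_Eq[OF assms(2)]) (rule der_true_Eq[OF assms(2) in_H insertI1], simp)
    then show ?thesis by (intro exI[of _ 2]) (auto simp: numeral_eq_Suc)
  next
    case Add_Zero
    then show ?thesis using assms
      by (intro exI[of _ 0]) (auto intro: der_true_Eq[of _ _ "Add (\<sigma> 0) Zero" "\<sigma> 0"])
  next
    case Add_Succ
    then show ?thesis using assms
      by (intro exI[of _ 0])
        (auto intro: der_true_Eq[of _ _ "Add (\<sigma> 0) (Succ (\<sigma> (Suc 0)))" "Succ (Add (\<sigma> 0) (\<sigma> (Suc 0)))"])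
  next
    case Mul_Zero
    then show ?thesis using assms
      by (intro exI[of _ 0]) (auto intro: der_true_Eq[of _ _ "Mul (\<sigma> 0) Zero" Zero])
  next
    case Mul_Succ
    then show ?thesis using assms
      by (intro exI[of _ 0]) (auto intro: der_true_Eq[of _ _ "Mul (\<sigma> 0) (Succ (\<sigma> (Suc 0)))"
          "Add (Mul (\<sigma> 0) (\<sigma> (Suc 0))) (\<sigma> 0)"])
  next
    case (Induction A)
    then show ?thesis using der_Induction[OF assms(2,3)] assms(4) by blast
  next
    case (F \<phi>)
    then have "der H (height Omega 3) \<rho> \<Gamma>" using der_F[OF assms(2,3)] assms(4) by blast
    then show ?thesis by (intro exI[of _ 3]) simp
  next
    case (L \<phi> A)
    then show ?thesis using der_L[OF assms(2,3)] assms(4) by blast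
  qed
  then show ?thesis using der_height_Omega_mono assms(2) by blast
qed

section \<open>Ranks of translated formulas\<close>

lemma entries_plus_Omega_fin:
  "Rep_ot (Omega + fin 0) = POm"
  "Rep_ot (Omega + fin (Suc k)) = PSq (POm # replicate (Suc k) (PSq []))"
  using Rep_plus_fin[of Omega k]
  by (simp_all add: Omega.rep_eq plus_ot.rep_eq fin.rep_eq pplus_def pfin_def)

lemma fin_plus_1: "fin k + fin 1 = fin (Suc k)"
proof (cases k)
  case 0
  then show ?thesis
    by (simp add: plus_ot.rep_eq fin.rep_eq pplus_def pfin_def of_entries_def flip: Rep_ot_inject)
next
  case (Suc j)
  have "replicate (Suc j) (PSq []) @ [PSq []] = replicate (Suc (Suc j)) (PSq [])"
    by (simp add: replicate_append_same)
  then show ?thesis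
    using Rep_plus_fin[of "fin k" 0] Suc by (simp add: fin.rep_eq pfin_def flip: Rep_ot_inject)
qed

lemma Omega_fin_plus_1: "Omega + fin k + fin 1 = Omega + fin (Suc k)"
proof (cases k)
  case 0
  then show ?thesis
    using entries_plus_Omega_fin(1) by (simp add: Rep_ot_inject flip: Omega.rep_eq)
next
  case (Suc j)
  have "replicate (Suc j) (PSq []) @ [PSq []] = replicate (Suc (Suc j)) (PSq [])"
    by (simp add: replicate_append_same)
  then show ?thesis
    using Rep_plus_fin[of "Omega + fin k" 0] Suc
    by (simp add: entries_plus_Omega_fin flip: Rep_ot_inject)
qed

lemma fin_less_Omega_fin: "fin k < Omega + fin (Suc m)"
  unfolding less_ot.rep_eq entries_plus_Omega_fin fin.rep_eq pfin_def
  by (cases k) (simp, simp only: replicate_Suc, rule plt_PSq_hd, simp)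

lemma Omega_fin_mono: "k < m \<Longrightarrow> Omega + fin k < Omega + fin m"
proof (cases k; cases m)
  fix i j assume "k < m" "k = Suc i" "m = Suc j"
  then show ?thesis
    using plt_replicate_prefix[of k m "[POm]" "PSq []"]
    by (simp add: less_ot.rep_eq entries_plus_Omega_fin)
qed (auto simp: less_ot.rep_eq entries_plus_Omega_fin)

text \<open>Literals have rank 0 or \<omega>*\<Omega> = \<Omega>, and every connective adds 1. The
  bound by the depth yields cut ranks \<Omega> + m that do not depend on the closing
  substitution.\<close>

lemma rk_cases:
  assumes "params A \<subseteq> {Omega}"
  shows "\<exists>k\<le>depth A. rk A = fin k \<or> rk A = Omega + fin k"
  using assms
proof (induction A)
  case (Pos P t)
  then show ?case
    by (auto simp: omega_times.rep_eq Omega.rep_eq entries_plus_Omega_fin simp flip: Rep_ot_inject)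
next
  case (Neg P t)
  then show ?case
    by (auto simp: omega_times.rep_eq Omega.rep_eq entries_plus_Omega_fin simp flip: Rep_ot_inject)
next
  case (And A B)
  \<comment> \<open>\<open>max\<close> is an if-then-else, so it returns one of its arguments
    whatever the order is.\<close>
  have "max (rk A) (rk B) = rk A \<or> max (rk A) (rk B) = rk B" by (simp add: max_def)
  moreover obtain i j where "i \<le> depth A" "rk A = fin i \<or> rk A = Omega + fin i"
    and "j \<le> depth B" "rk B = fin j \<or> rk B = Omega + fin j"
    using And by auto
  ultimately obtain k where "k \<le> max (depth A) (depth B)"
    "max (rk A) (rk B) = fin k \<or> max (rk A) (rk B) = Omega + fin k"
    by (metis max.coboundedI1 max.coboundedI2)
  then show ?case using fin_plus_1 Omega_fin_plus_1 by (intro exI[of _ "Suc k"]) auto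
next
  case (Or A B)
  have "max (rk A) (rk B) = rk A \<or> max (rk A) (rk B) = rk B" by (simp add: max_def)
  moreover obtain i j where "i \<le> depth A" "rk A = fin i \<or> rk A = Omega + fin i"
    and "j \<le> depth B" "rk B = fin j \<or> rk B = Omega + fin j"
    using Or by auto
  ultimately obtain k where "k \<le> max (depth A) (depth B)"
    "max (rk A) (rk B) = fin k \<or> max (rk A) (rk B) = Omega + fin k"
    by (metis max.coboundedI1 max.coboundedI2)
  then show ?case using fin_plus_1 Omega_fin_plus_1 by (intro exI[of _ "Suc k"]) auto
next
  case (All A)
  then obtain k where "k \<le> depth A" "rk A = fin k \<or> rk A = Omega + fin k" by auto
  then show ?case using fin_plus_1 Omega_fin_plus_1 by (intro exI[of _ "Suc k"]) auto
next
  case (Ex A)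
  then obtain k where "k \<le> depth A" "rk A = fin k \<or> rk A = Omega + fin k" by auto
  then show ?case using fin_plus_1 Omega_fin_plus_1 by (intro exI[of _ "Suc k"]) auto
qed auto

lemma rk_less:
  assumes "params A \<subseteq> {Omega}" "depth A < m"
  shows "rk A < Omega + fin m"
proof -
  obtain k where "k \<le> depth A" "rk A = fin k \<or> rk A = Omega + fin k"
    using rk_cases[OF assms(1)] by blast
  then show ?thesis
    using fin_less_Omega_fin[of k "m - 1"] Omega_fin_mono[of k m] assms(2) by auto
qed

text \<open>The bounds must not depend on the closing substitution, since \<open>tait.All\<close> needs all numerals at once.\<close>

definition embeds :: "opform fm set \<Rightarrow> nat \<Rightarrow> nat \<Rightarrow> bool" where
  "embeds \<Gamma> m n \<longleftrightarrow> (\<forall>\<sigma> H. closing \<sigma> \<longrightarrow> nice H \<longrightarrow>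
    der H (height Omega n) (Omega + fin m) (close_fm \<sigma> ` \<Gamma>))"

section \<open>Induction on finitary derivations\<close>

lemma embedsD:
  "embeds \<Gamma> m n \<Longrightarrow> closing \<sigma> \<Longrightarrow> nice H \<Longrightarrow> der H (height Omega n) (Omega + fin m) (close_fm \<sigma> ` \<Gamma>)"
  by (simp add: embeds_def)

lemma embeds_SucI:
  assumes "\<And>m n. m0 \<le> m \<Longrightarrow> n0 \<le> n \<Longrightarrow> embeds \<Gamma> m (Suc n)"
  shows "\<exists>m0 n0. \<forall>m\<ge>m0. \<forall>n\<ge>n0. embeds \<Gamma> m n"
proof (intro exI allI impI)
  fix m n assume "m0 \<le> m" "Suc n0 \<le> n"
  then show "embeds \<Gamma> m n" using assms[of m "n - 1"] by simp
qed

text \<open>The bounds hold for all large m and n, so that premises with different thresholds can be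
  used at the same m and n.\<close>

lemma embedding:
  assumes "tait ID1 \<Gamma>"
  shows "\<exists>m0 n0. \<forall>m\<ge>m0. \<forall>n\<ge>n0. embeds \<Gamma> m n"
  using assms
proof induction
  case (Id \<Gamma> A)
  have "embeds \<Gamma> m n" for m n
    unfolding embeds_def
  proof (intro allI impI)
    fix \<sigma> and H :: "ot set \<Rightarrow> ot set" assume \<sigma>: "closing \<sigma>" and H: "nice H"
    have \<Gamma>: "close_fm \<sigma> A \<in> close_fm \<sigma> ` \<Gamma>" "neg (close_fm \<sigma> A) \<in> close_fm \<sigma> ` \<Gamma>"
      using imageI[OF Id(2), of "close_fm \<sigma>"] imageI[OF Id(3), of "close_fm \<sigma>"]
      by (simp_all add: plus_fm_neg subst_neg)
    show "der H (height Omega n) (Omega + fin m) (close_fm \<sigma> ` \<Gamma>)"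
      by (rule der_omega_pow_Omega[OF H], rule der_tautology[OF H _ _ params_plus_fm \<sigma> \<sigma> _ \<Gamma>])
        (use H in auto)
  qed
  then show ?case by blast
next
  case (Axiom \<Gamma> A)
  have "embeds \<Gamma> m n" if "n \<ge> 5" for m n
    unfolding embeds_def
    using that Axiom(3) by (auto intro!: der_height_Omega_mono[OF _ der_ID1[OF Axiom(2)]])
  then show ?case by blast
next
  case (And A B \<Gamma>)
  then obtain m0 n0 m1 n1 where IH:
    "\<And>m n. m \<ge> m0 \<Longrightarrow> n \<ge> n0 \<Longrightarrow> embeds (insert A \<Gamma>) m n"
    "\<And>m n. m \<ge> m1 \<Longrightarrow> n \<ge> n1 \<Longrightarrow> embeds (insert B \<Gamma>) m n" by metis
  have "embeds \<Gamma> m (Suc n)" if "m \<ge> max m0 m1" "n \<ge> max n0 n1" for m n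
    unfolding embeds_def
  proof (intro allI impI)
    fix \<sigma> and H :: "ot set \<Rightarrow> ot set" assume \<sigma>: "closing \<sigma>" and H: "nice H"
    have \<Gamma>: "And (close_fm \<sigma> A) (close_fm \<sigma> B) \<in> close_fm \<sigma> ` \<Gamma>"
      using And(1) by (metis image_eqI plus_fm_simps(5) subst.simps(5))
    show "der H (height Omega (Suc n)) (Omega + fin m) (close_fm \<sigma> ` \<Gamma>)"
      by (rule der_And[OF H _ \<Gamma> height_Suc_mono height_Suc_mono])
        (use embedsD[OF IH(1) \<sigma> H, of m n] embedsD[OF IH(2) \<sigma> H, of m n] that H in auto)
  qed
  then show ?case by (rule embeds_SucI)
next
  case (Or1 A B \<Gamma>)
  then obtain m0 n0 where IH: "\<And>m n. m \<ge> m0 \<Longrightarrow> n \<ge> n0 \<Longrightarrow> embeds (insert A \<Gamma>) m n" by metis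
  have "embeds \<Gamma> m (Suc n)" if "m \<ge> m0" "n \<ge> n0" for m n
    unfolding embeds_def
  proof (intro allI impI)
    fix \<sigma> and H :: "ot set \<Rightarrow> ot set" assume \<sigma>: "closing \<sigma>" and H: "nice H"
    have \<Gamma>: "Or (close_fm \<sigma> A) (close_fm \<sigma> B) \<in> close_fm \<sigma> ` \<Gamma>"
      using Or1(1) by (metis image_eqI plus_fm_simps(6) subst.simps(6))
    show "der H (height Omega (Suc n)) (Omega + fin m) (close_fm \<sigma> ` \<Gamma>)"
      by (rule der_Or1[OF H _ \<Gamma> fin_less_height height_Suc_mono])
        (use embedsD[OF IH \<sigma> H, of m n] that H in auto)
  qed
  then show ?case by (rule embeds_SucI)
next
  case (Or2 A B \<Gamma>)
  then obtain m0 n0 where IH: "\<And>m n. m \<ge> m0 \<Longrightarrow> n \<ge> n0 \<Longrightarrow> embeds (insert B \<Gamma>) m n" by metis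
  have "embeds \<Gamma> m (Suc n)" if "m \<ge> m0" "n \<ge> n0" for m n
    unfolding embeds_def
  proof (intro allI impI)
    fix \<sigma> and H :: "ot set \<Rightarrow> ot set" assume \<sigma>: "closing \<sigma>" and H: "nice H"
    have \<Gamma>: "Or (close_fm \<sigma> A) (close_fm \<sigma> B) \<in> close_fm \<sigma> ` \<Gamma>"
      using Or2(1) by (metis image_eqI plus_fm_simps(6) subst.simps(6))
    show "der H (height Omega (Suc n)) (Omega + fin m) (close_fm \<sigma> ` \<Gamma>)"
      by (rule der_Or2[OF H _ \<Gamma> fin_less_height height_Suc_mono])
        (use embedsD[OF IH \<sigma> H, of m n] that H in auto)
  qed
  then show ?case by (rule embeds_SucI)
next
  case (All A \<Gamma>)
  then obtain m0 n0 where IH: "\<And>m n. m \<ge> m0 \<Longrightarrow> n \<ge> n0 \<Longrightarrow> embeds (insert A (shift ` \<Gamma>)) m n"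
    by metis
  have "embeds \<Gamma> m (Suc n)" if "m \<ge> m0" "n \<ge> n0" for m n
    unfolding embeds_def
  proof (intro allI impI)
    fix \<sigma> and H :: "ot set \<Rightarrow> ot set" assume \<sigma>: "closing \<sigma>" and H: "nice H"
    have \<Gamma>: "All (subst (up \<sigma>) (plus_fm A)) \<in> close_fm \<sigma> ` \<Gamma>"
      using All(1) by (metis image_eqI plus_fm_simps(7) subst.simps(7))
    show "der H (height Omega (Suc n)) (Omega + fin m) (close_fm \<sigma> ` \<Gamma>)"
    proof (rule der_All[OF H _ \<Gamma>])
      fix k
      have "plus_fm (shift B) = shift (plus_fm B)" for B by (simp add: shift_def plus_fm_subst)
      \<comment> \<open>On the context the shift cancels against the extended substitution, while
        \<open>A\<close> becomes its instance at \<open>num k\<close>; one pair of bounds thus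
        serves all premises of the \<omega>-rule.\<close>
      then have "close_fm (case_nat (num k) \<sigma>) ` insert A (shift ` \<Gamma>) =
          insert (inst (subst (up \<sigma>) (plus_fm A)) (num k)) (close_fm \<sigma> ` \<Gamma>)"
        by (simp add: image_image subst_shift inst_subst_up)
      then show "\<exists>\<alpha>'<height Omega (Suc n). der H \<alpha>' (Omega + fin m)
          (insert (inst (subst (up \<sigma>) (plus_fm A)) (num k)) (close_fm \<sigma> ` \<Gamma>))"
        using embedsD[OF IH[OF that] closing_case_nat[OF \<sigma> fv_num] H, of k] height_Suc_mono[of Omega n "Suc n"]
        by (intro exI[of _ "height Omega n"]) auto
    qed (use H in auto)
  qed
  then show ?case by (rule embeds_SucI)
next
  case (Ex A \<Gamma> t)
  then obtain m0 n0 where IH: "\<And>m n. m \<ge> m0 \<Longrightarrow> n \<ge> n0 \<Longrightarrow> embeds (insert (inst A t) \<Gamma>) m n" by metis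
  \<comment> \<open>The closed witness need not be a numeral, as \<open>der_Ex\<close> demands.
    Hence a cut with A(t): its negation is refuted by the existential formula, instantiated with the
    numeral of the same value. The threshold for m bounds the rank of this cut.\<close>
  have "embeds \<Gamma> m (Suc n)" if m: "m \<ge> max m0 (Suc (depth (plus_fm A)))" and n: "n \<ge> n0" for m n
    unfolding embeds_def
  proof (intro allI impI)
    fix \<sigma> and H :: "ot set \<Rightarrow> ot set" assume \<sigma>: "closing \<sigma>" and H: "nice H"
    let ?\<Gamma> = "close_fm \<sigma> ` \<Gamma>" and ?t = "subst_tm \<sigma> t" and ?A = "plus_fm A"
    let ?D = "subst (case_nat ?t \<sigma>) ?A"
    have \<Gamma>: "Ex (subst (up \<sigma>) ?A) \<in> ?\<Gamma>"
      using Ex(1) by (metis image_eqI plus_fm_simps(8) subst.simps(8))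
    show "der H (height Omega (Suc n)) (Omega + fin m) ?\<Gamma>"
    proof (rule der_Cut[OF H, where A = ?D])
      show "der H (height Omega n) (Omega + fin m) (insert ?D ?\<Gamma>)"
        using embedsD[OF IH \<sigma> H, of m n] m n by (simp add: plus_fm_inst subst_inst)
      show "der H (height Omega n) (Omega + fin m) (insert (neg ?D) ?\<Gamma>)"
      proof (rule der_Ex[OF H, where n = "tval ?t" and A = "subst (up \<sigma>) ?A"])
        show "der H (omega_pow Omega (2 * depth ?A)) (Omega + fin m)
            (insert (inst (subst (up \<sigma>) ?A) (num (tval ?t))) (insert (neg ?D) ?\<Gamma>))"
          by (rule der_tautology[where \<sigma> = "case_nat (num (tval ?t)) \<sigma>" and \<tau> = "case_nat ?t \<sigma>"])
            (use \<sigma> H params_plus_fm in \<open>auto simp: inst_subst_up\<close>)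
      qed (use \<Gamma> H in \<open>auto intro: fin_less_height omega_pow_less_height\<close>)
      show "fv ?D = {}" using \<sigma> by (intro fv_subst_closing closing_case_nat) auto
      show "params ?D \<subseteq> {Omega}" using params_plus_fm by simp
      show "rk ?D < Omega + fin m" using rk_less[OF params_plus_fm, of A m] m by simp
    qed (use \<sigma> H in \<open>auto intro: height_Suc_mono\<close>)
  qed
  then show ?case by (rule embeds_SucI)
next
  case (Cut A \<Gamma>)
  then obtain m0 n0 m1 n1 where IH:
    "\<And>m n. m \<ge> m0 \<Longrightarrow> n \<ge> n0 \<Longrightarrow> embeds (insert A \<Gamma>) m n"
    "\<And>m n. m \<ge> m1 \<Longrightarrow> n \<ge> n1 \<Longrightarrow> embeds (insert (neg A) \<Gamma>) m n" by metis
  have "embeds \<Gamma> m (Suc n)"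
    if m: "m \<ge> max (max m0 m1) (Suc (depth (plus_fm A)))" and n: "n \<ge> max n0 n1" for m n
    unfolding embeds_def
  proof (intro allI impI)
    fix \<sigma> and H :: "ot set \<Rightarrow> ot set" assume \<sigma>: "closing \<sigma>" and H: "nice H"
    show "der H (height Omega (Suc n)) (Omega + fin m) (close_fm \<sigma> ` \<Gamma>)"
    proof (rule der_Cut[OF H, where A = "close_fm \<sigma> A"])
      show "der H (height Omega n) (Omega + fin m) (insert (close_fm \<sigma> A) (close_fm \<sigma> ` \<Gamma>))"
        using embedsD[OF IH(1) \<sigma> H, of m n] m n by simp
      show "der H (height Omega n) (Omega + fin m) (insert (neg (close_fm \<sigma> A)) (close_fm \<sigma> ` \<Gamma>))"
        using embedsD[OF IH(2) \<sigma> H, of m n] m n by (simp add: plus_fm_neg subst_neg)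
      show "params (close_fm \<sigma> A) \<subseteq> {Omega}" using params_plus_fm by simp
      show "rk (close_fm \<sigma> A) < Omega + fin m" using rk_less[OF params_plus_fm, of A m] m by simp
    qed (use \<sigma> H in \<open>auto intro: height_Suc_mono\<close>)
  qed
  then show ?case by (rule embeds_SucI)
qed

theorem theorem6p5:
  fixes \<psi> :: "opform fm" and H :: "ot set \<Rightarrow> ot set"
  assumes "sentence \<psi>"
    and "ID1_proves \<psi>"
    and "nice H"
  shows "\<exists>m n :: nat. derivation H (Omega + Omega + fin n) (Omega + fin m) {plus_fm \<psi>}"
proof -
  obtain m n where "embeds {\<psi>} m n"
    using embedding assms(2) unfolding ID1_proves_def by blast
  \<comment> \<open>The choice of \<open>Zero\<close> is arbitrary, as the sentence \<psi> is
    unchanged by any substitution.\<close>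
  then have "der H (height Omega n) (Omega + fin m) (close_fm (\<lambda>_. Zero) ` {\<psi>})"
    using assms(3) by (intro embedsD) (auto simp: closing_def)
  moreover have fv: "fv (plus_fm \<psi>) = {}"
    using assms(1) by (simp add: sentence_def plus_fm_def)
  then have "close_fm (\<lambda>_. Zero) \<psi> = plus_fm \<psi>"
    using subst_cong[of "plus_fm \<psi>" "\<lambda>_. Zero" Var] by simp
  moreover have "admissible H {plus_fm \<psi>}"
    using fv params_plus_fm[of \<psi>] assms(3)
    by (auto simp: admissible_def sequent_def inf_sentence_def sentence_def)
  ultimately have "derivation H (height Omega n) (Omega + fin m) {plus_fm \<psi>}"
    by (simp add: der_def)
  \<comment> \<open>The witness for the finite part is n+1, since \<open>height Omega n\<close> is
    \<Omega>*2 + n + 1.\<close>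
  then show ?thesis unfolding height_Omega_eq by blast
qed

end
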